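(* There is a $\mathrm{poly}(m,n,\exp(k))$-time randomized algorithm with the following guarantee. Let the input be a triangle-free CSP instance over $n$ Boolean variables with $m$ arbitrary constraints, each of arity between $2$ and $k$, and assume each variable participates in at most $D$ constraints. Let $\mathfrak{P}$ be the associated polynomial. Then the algorithm outputs a random assignment $\boldsymbol{x}\in\{\pm1\}^n$ with \[ \mathbb{E}[\mathfrak{P}(\boldsymbol{x})] \geq \exp(-O(k))\cdot\sum_{i=1}^n\frac{\sqrt{\deg(i)}}{m} \geq \exp(-O(k))\cdot\frac{1}{\sqrt{D}}. \]
   Context: A CSP instance has Boolean variables $x_1,\dots,x_n\in\{\pm1\}$ and $m$ constraints $(P_\ell,S_\ell)$, $\ell\in[m]$, where the scope $S_\ell$ is an ordered $r$-tuple of distinct indices in $[n]$ ($r$ is the arity) and $P_\ell:\{\pm1\}^r\to\{0,1\}$ depends on all $r$ coordinates; the constraint is satisfied iff $P_\ell(x_{S_\ell})=1$. $\deg(i)$ is the number of constraints whose scope contains $i$. The instance is triangle-free if the scopes of any two distinct constraints intersect in at most one variable and there are no three distinct constraints whose scopes pairwise intersect. The associated polynomial is $\mathfrak{P}(x)=\frac1m\sum_{\ell=1}^m\big(P_\ell(x_{S_\ell})-\mathbb{E}[P_\ell]\big)$, where $\mathbb{E}[P_\ell]$ is the expectation of $P_\ell$ under a uniformly random input; thus $\mathfrak{P}(x)$ is the fraction of constraints satisfied by $x$ minus the expected fraction satisfied by a uniformly random assignment. *)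

theory Defs
  imports "HOL-Probability.Probability"
begin

section \<open>Constraint satisfaction problems\<close>

text \<open>Variables are numbered \<open>0, \<dots>, n - 1\<close>. A predicate takes the values at the scope, in order,
  as a list of signs; \<open>True\<close> and \<open>False\<close> stand for the values 1 and 0.\<close>

datatype cons = Cons_on (pred: "int list \<Rightarrow> bool") (scope: "nat list")

datatype csp = CSP (nvars: nat) (constraints: "cons list")

definition cube :: "nat \<Rightarrow> int list set" where
  "cube r = {z. length z = r \<and> set z \<subseteq> {-1, 1}}"

abbreviation arity :: "cons \<Rightarrow> nat" where
  "arity c \<equiv> length (scope c)"

definition depends_on_all :: "nat \<Rightarrow> (int list \<Rightarrow> bool) \<Rightarrow> bool" where
  "depends_on_all r P \<longleftrightarrow> (\<forall>i<r. \<exists>z\<in>cube r. P (z[i := - z ! i]) \<noteq> P z)"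

definition valid_csp :: "csp \<Rightarrow> bool" where
  "valid_csp I \<longleftrightarrow> (\<forall>c\<in>set (constraints I).
     distinct (scope c) \<and> set (scope c) \<subseteq> {..<nvars I} \<and> depends_on_all (arity c) (pred c))"

abbreviation ncons :: "csp \<Rightarrow> nat" where
  "ncons I \<equiv> length (constraints I)"

abbreviation scope_at :: "csp \<Rightarrow> nat \<Rightarrow> nat set" where
  "scope_at I l \<equiv> set (scope (constraints I ! l))"

definition deg :: "csp \<Rightarrow> nat \<Rightarrow> nat" where
  "deg I i = card {l. l < ncons I \<and> i \<in> scope_at I l}"

text \<open>Three constraints that merely share a single common variable do not form a triangle
  (otherwise no variable could have degree above 2); the three pairwise intersections of a
  triangle have no variable in common.\<close>

definition triangle_free :: "csp \<Rightarrow> bool" where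
  "triangle_free I \<longleftrightarrow>
     (\<forall>a<ncons I. \<forall>b<ncons I. a \<noteq> b \<longrightarrow> card (scope_at I a \<inter> scope_at I b) \<le> 1) \<and>
     \<not> (\<exists>a<ncons I. \<exists>b<ncons I. \<exists>c<ncons I. a \<noteq> b \<and> b \<noteq> c \<and> a \<noteq> c \<and>
          scope_at I a \<inter> scope_at I b \<noteq> {} \<and>
          scope_at I b \<inter> scope_at I c \<noteq> {} \<and>
          scope_at I a \<inter> scope_at I c \<noteq> {} \<and>
          scope_at I a \<inter> scope_at I b \<inter> scope_at I c = {})"

definition mean :: "cons \<Rightarrow> real" where
  "mean c = measure_pmf.expectation (pmf_of_set (cube (arity c))) (\<lambda>z. of_bool (pred c z))"

definition assoc_poly :: "csp \<Rightarrow> (nat \<Rightarrow> int) \<Rightarrow> real" where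
  "assoc_poly I x =
     (1 / real (ncons I)) *
     (\<Sum>c\<leftarrow>constraints I. of_bool (pred c (map x (scope c))) - mean c)"


section \<open>Randomized algorithms\<close>

text \<open>A structured random access machine with integer registers, an integer memory with indirect
  addressing, and fair coin tosses. Every step has unit cost. Addition and subtraction are the
  only arithmetic operations, so the bit length of the numbers grows by at most a constant per
  step, and polynomial time here is polynomial time for (probabilistic) Turing machines.\<close>

type_synonym state = "(string \<Rightarrow> int) \<times> (int \<Rightarrow> int)"

datatype aexp = N int | V string | Load aexp | Plus aexp aexp | Minus aexp aexp

datatype bexp = Less aexp aexp | BNot bexp | BAnd bexp bexp

datatype com =
    Skip
  | Assign string aexp
  | Store aexp aexp
  | Flip string
  | Seq com com
  | Cond bexp com com
  | While bexp com

fun aval :: "aexp \<Rightarrow> state \<Rightarrow> int" where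
  "aval (N a) s = a"
| "aval (V v) s = fst s v"
| "aval (Load e) s = snd s (aval e s)"
| "aval (Plus e f) s = aval e s + aval f s"
| "aval (Minus e f) s = aval e s - aval f s"

fun bval :: "bexp \<Rightarrow> state \<Rightarrow> bool" where
  "bval (Less e f) s \<longleftrightarrow> aval e s < aval f s"
| "bval (BNot b) s \<longleftrightarrow> \<not> bval b s"
| "bval (BAnd b c) s \<longleftrightarrow> bval b s \<and> bval c s"

fun step :: "com \<Rightarrow> state \<Rightarrow> (com \<times> state) pmf" where
  "step Skip s = return_pmf (Skip, s)"
| "step (Assign v e) s = return_pmf (Skip, (fst s)(v := aval e s), snd s)"
| "step (Store e f) s = return_pmf (Skip, fst s, (snd s)(aval e s := aval f s))"
| "step (Flip v) s =
     map_pmf (\<lambda>b. (Skip, (fst s)(v := of_bool b), snd s)) (bernoulli_pmf (1 / 2))"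
| "step (Seq c d) s =
     (if c = Skip then return_pmf (d, s) else map_pmf (\<lambda>(c', s'). (Seq c' d, s')) (step c s))"
| "step (Cond b c d) s = return_pmf (if bval b s then c else d, s)"
| "step (While b c) s = return_pmf (Cond b (Seq c (While b c)) Skip, s)"

fun run :: "nat \<Rightarrow> com \<times> state \<Rightarrow> (com \<times> state) pmf" where
  "run 0 cfg = return_pmf cfg"
| "run (Suc t) cfg = bind_pmf (step (fst cfg) (snd cfg)) (run t)"

text \<open>The program \<^term>\<open>Skip\<close> is the halted one; being halted is preserved by further steps.\<close>

definition halts_within :: "com \<Rightarrow> state \<Rightarrow> nat \<Rightarrow> bool" where
  "halts_within p s t \<longleftrightarrow> (\<forall>cfg\<in>set_pmf (run t (p, s)). fst cfg = Skip)"

text \<open>The input occupies the memory cells \<open>0, 1, \<dots>\<close>; everything else is 0 initially.\<close>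

definition init_state :: "int list \<Rightarrow> state" where
  "init_state xs =
     (\<lambda>v. 0, \<lambda>a. if 0 \<le> a \<and> nat a < length xs then xs ! nat a else 0)"

text \<open>The output is an assignment: the value of variable \<open>i\<close> is the final content of cell \<open>i\<close>.\<close>

definition output_dist :: "com \<Rightarrow> state \<Rightarrow> nat \<Rightarrow> (nat \<Rightarrow> int) pmf" where
  "output_dist p s t = map_pmf (\<lambda>(c, s') i. snd s' (int i)) (run t (p, s))"

text \<open>A predicate of arity \<open>r\<close> is given by its truth table: entry \<open>t < 2 ^ r\<close> is its value at the
  point whose coordinate \<open>i\<close> is \<open>-1\<close> iff bit \<open>i\<close> of \<open>t\<close> is set. An instance is \<open>n\<close>, \<open>m\<close>, followed
  for each constraint by its arity, scope and truth table.\<close>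

definition truth_table :: "nat \<Rightarrow> (int list \<Rightarrow> bool) \<Rightarrow> int list" where
  "truth_table r P =
     map (\<lambda>t. of_bool (P (map (\<lambda>i. if bit t i then -1 else 1) [0..<r]))) [0..<2 ^ r]"

definition encode_cons :: "cons \<Rightarrow> int list" where
  "encode_cons c = int (arity c) # map int (scope c) @ truth_table (arity c) (pred c)"

definition encode_csp :: "csp \<Rightarrow> int list" where
  "encode_csp I =
     int (nvars I) # int (ncons I) # concat (map encode_cons (constraints I))"

end

theory Submission
  imports Defs
begin

text \<open>
  Toss three fair coins per variable: is it greedy, and two independent signs \<open>y\<close> and \<open>y'\<close>. A
  constraint is active for \<open>j\<close> if \<open>j\<close> is its only greedy variable; write \<open>b(y)\<close> for the gain of
  setting \<open>j\<close> to 1 rather than to -1 in such a constraint when the other variables follow \<open>y\<close>.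
  Variable \<open>j\<close> receives the sign of \<open>Z\<close>, the sum of \<open>b(y) - b(y')\<close> over the constraints active
  for \<open>j\<close>, and keeps its own sign \<open>y\<close> if \<open>Z = 0\<close>. Subtracting the independent copy makes this
  choice symmetric: exchanging \<open>y\<close> and \<open>y'\<close> on the variables that \<open>Z\<close> reads, and negating the sign
  of \<open>j\<close>, flips the output at \<open>j\<close> and, by triangle-freeness, at no other variable of an inactive
  constraint. So inactive constraints see uniform inputs and contribute nothing, and the active
  ones contribute a quarter of the sum of the \<open>E|Z|\<close>. The summands of \<open>Z\<close> are symmetric,
  uncorrelated under partial exchanges, and nonzero with probability at least \<open>8\<^sup>-\<^sup>k\<close>, so that the
  second and fourth moments of \<open>Z\<close> and the inequality \<open>\<bar>z\<bar> \<ge> \<alpha>z\<^sup>2 - \<alpha>\<^sup>3z\<^sup>4/4\<close> give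
  \<open>E|Z| \<ge> \<surd>deg(j) / (10 \<cdot> 64\<^sup>k)\<close>.
\<close>

section \<open>Running times and output distributions of programs\<close>

lemma run_Skip [simp]: "run t (Skip, s) = return_pmf (Skip, s)"
  by (induction t) (auto simp: bind_return_pmf)

lemma run_add: "run (a + b) cfg = bind_pmf (run a cfg) (run b)"
proof (induction a arbitrary: cfg)
  case (Suc a)
  then have "run (a + b) = (\<lambda>cfg. bind_pmf (run a cfg) (run b))" by (rule ext)
  then show ?case by (simp add: bind_assoc_pmf)
qed (simp add: bind_return_pmf)

lemma run_halted:
  assumes "\<forall>cfg'\<in>set_pmf (run t cfg). fst cfg' = Skip"
  shows "run (t + e) cfg = run t cfg"
proof -
  have "run (t + e) cfg = bind_pmf (run t cfg) return_pmf"
    unfolding run_add using assms by (intro bind_pmf_cong) (auto simp: prod_eq_iff)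
  then show ?thesis by (simp add: bind_return_pmf')
qed

text \<open>The extra step is the one in which \<open>Seq\<close> drops a halted first component.
  When \<open>c\<close> halts before its \<open>t\<close> steps are over, the surplus falls to
  \<open>d\<close>, which stays halted after \<open>u\<close> steps; so one fixed budget serves
  every outcome of the coins.\<close>

lemma run_Seq:
  assumes "\<forall>cfg\<in>set_pmf (run t (c, s)). fst cfg = Skip"
    and "\<forall>cfg\<in>set_pmf (run t (c, s)). \<forall>cfg'\<in>set_pmf (run u (d, snd cfg)). fst cfg' = Skip"
  shows "run (t + 1 + u) (Seq c d, s) = bind_pmf (run t (c, s)) (\<lambda>cfg. run u (d, snd cfg))"
  using assms
proof (induction t arbitrary: c s)
  case 0
  then show ?case by (simp add: bind_return_pmf)
next
  case (Suc t)
  show ?case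
  proof (cases "c = Skip")
    case True
    with Suc.prems run_halted[of u "(d, s)" "Suc t"] show ?thesis
      by (simp add: bind_return_pmf add_ac)
  next
    case False
    have "run (Suc t + 1 + u) (Seq c d, s) =
        bind_pmf (step c s) (\<lambda>cfg. run (t + 1 + u) (Seq (fst cfg) d, snd cfg))"
      using False by (simp add: bind_map_pmf case_prod_beta)
    also have "\<dots> = bind_pmf (step c s) (\<lambda>cfg. bind_pmf (run t cfg) (\<lambda>cfg. run u (d, snd cfg)))"
    proof (intro bind_pmf_cong refl)
      fix cfg assume cfg: "cfg \<in> set_pmf (step c s)"
      have "run (t + 1 + u) (Seq (fst cfg) d, snd cfg) =
          bind_pmf (run t (fst cfg, snd cfg)) (\<lambda>cfg. run u (d, snd cfg))"
        using Suc.prems cfg by (intro Suc.IH) auto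
      then show "run (t + 1 + u) (Seq (fst cfg) d, snd cfg) =
          bind_pmf (run t cfg) (\<lambda>cfg. run u (d, snd cfg))" by simp
    qed
    finally show ?thesis by (simp add: bind_assoc_pmf)
  qed
qed

text \<open>The ghost value \<open>\<omega>\<close>, distributed according to \<open>U\<close>, records the coins behind the final state.\<close>

definition yields :: "com \<Rightarrow> state \<Rightarrow> nat \<Rightarrow> 'w pmf \<Rightarrow> ('w \<Rightarrow> state \<Rightarrow> bool) \<Rightarrow> bool" where
  "yields c s t U Q \<longleftrightarrow> rel_pmf (\<lambda>\<omega> cfg. fst cfg = Skip \<and> Q \<omega> (snd cfg)) U (run t (c, s))"

lemma rel_pmf_right:
  assumes "rel_pmf R p q" "y \<in> set_pmf q"
  shows "\<exists>x\<in>set_pmf p. R x y"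
  using assms(1)
proof cases
  case (1 pq)
  with assms(2) obtain z where "z \<in> set_pmf pq" "snd z = y" by auto
  then show ?thesis using 1(1)[of "fst z" "snd z"] 1(2) by auto
qed

lemma yields_halted:
  assumes "yields c s t U Q"
  shows "\<forall>cfg\<in>set_pmf (run t (c, s)). fst cfg = Skip \<and> (\<exists>\<omega>\<in>set_pmf U. Q \<omega> (snd cfg))"
  using rel_pmf_right[OF assms[unfolded yields_def]] by blast

lemma yields_mono:
  assumes "yields c s t U Q" "t \<le> t'" "\<And>\<omega> s'. \<omega> \<in> set_pmf U \<Longrightarrow> Q \<omega> s' \<Longrightarrow> R \<omega> s'"
  shows "yields c s t' U R"
proof -
  have "run t' (c, s) = run t (c, s)"
    using run_halted[of t "(c, s)" "t' - t"] yields_halted[OF assms(1)] assms(2) by simp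
  moreover have "rel_pmf (\<lambda>\<omega> cfg. fst cfg = Skip \<and> R \<omega> (snd cfg)) U (run t (c, s))"
    using assms(1) unfolding yields_def by (rule pmf.rel_mono_strong) (use assms(3) in auto)
  ultimately show ?thesis by (simp add: yields_def)
qed

text \<open>Couplings compose along \<open>bind_pmf\<close>: \<open>U\<close> describes the coins of
  \<open>c\<close>, and \<open>W \<omega>\<close> continues with those of \<open>d\<close>. The
  budgets add up, plus one step for the transition.\<close>

lemma yields_Seq:
  assumes c: "yields c s t U Q"
    and d: "\<And>\<omega> s'. \<omega> \<in> set_pmf U \<Longrightarrow> Q \<omega> s' \<Longrightarrow> yields d s' u (W \<omega>) R"
    and le: "t + 1 + u \<le> t'"
  shows "yields (Seq c d) s t' (bind_pmf U W) R"
proof -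
  have "run (t + 1 + u) (Seq c d, s) = bind_pmf (run t (c, s)) (\<lambda>cfg. run u (d, snd cfg))"
    using yields_halted[OF c] yields_halted[OF d] by (intro run_Seq) blast+
  moreover have "rel_pmf (\<lambda>\<omega> cfg. fst cfg = Skip \<and> R \<omega> (snd cfg)) (bind_pmf U W)
      (bind_pmf (run t (c, s)) (\<lambda>cfg. run u (d, snd cfg)))"
  proof (rule rel_pmf_bindI)
    \<comment> \<open>The coupling is made to remember that \<open>\<omega>\<close> lies in the
      support of \<open>U\<close>, as \<open>d\<close> is controlled only there.\<close>
    show "rel_pmf (\<lambda>\<omega> cfg. \<omega> \<in> set_pmf U \<and> fst cfg = Skip \<and> Q \<omega> (snd cfg)) U (run t (c, s))"
      using c unfolding yields_def by (rule pmf.rel_mono_strong) auto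
  qed (use d in \<open>auto simp: yields_def\<close>)
  ultimately have "yields (Seq c d) s (t + 1 + u) (bind_pmf U W) R" by (simp add: yields_def)
  from yields_mono[OF this le] show ?thesis by blast
qed

text \<open>The second command adds no ghost randomness: the value recorded for \<open>c\<close> is
  handed on as it is.\<close>

lemma yields_Seq_det:
  assumes "yields c s t U Q"
    and "\<And>\<omega> s'. \<omega> \<in> set_pmf U \<Longrightarrow> Q \<omega> s' \<Longrightarrow> yields d s' u (return_pmf \<omega>) R"
    and "t + 1 + u \<le> t'"
  shows "yields (Seq c d) s t' U R"
  using yields_Seq[where W = return_pmf and R = R, OF assms(1) _ assms(3)] assms(2)
  by (simp add: bind_return_pmf')

lemma yields_Seq_init:
  assumes "yields c s t (return_pmf \<omega>) (\<lambda>_. Q)"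
    and "\<And>s'. Q s' \<Longrightarrow> yields d s' u U R"
    and "t + 1 + u \<le> t'"
  shows "yields (Seq c d) s t' U R"
  using yields_Seq[OF assms(1) assms(2) assms(3)] by (simp add: bind_return_pmf)

section \<open>Straight-line code and single coin tosses\<close>

fun straight :: "com \<Rightarrow> bool" where
  "straight (Seq c d) \<longleftrightarrow> straight c \<and> straight d"
| "straight (Cond b c d) \<longleftrightarrow> straight c \<and> straight d"
| "straight (Flip v) \<longleftrightarrow> False"
| "straight (While b c) \<longleftrightarrow> False"
| "straight _ \<longleftrightarrow> True"

fun exec :: "com \<Rightarrow> state \<Rightarrow> state" where
  "exec (Assign v e) s = ((fst s)(v := aval e s), snd s)"
| "exec (Store e f) s = (fst s, (snd s)(aval e s := aval f s))"
| "exec (Seq c d) s = exec d (exec c s)"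
| "exec (Cond b c d) s = (if bval b s then exec c s else exec d s)"
| "exec _ s = s"

text \<open>A bound that covers both branches of a conditional; the cheaper branch idles in the
  halted state for the difference, so that \<open>run_straight\<close> holds with one
  budget.\<close>

fun cost :: "com \<Rightarrow> nat" where
  "cost (Seq c d) = cost c + 1 + cost d"
| "cost (Cond b c d) = 1 + max (cost c) (cost d)"
| "cost _ = 1"

lemma run_straight: "straight c \<Longrightarrow> run (cost c) (c, s) = return_pmf (Skip, exec c s)"
proof (induction c arbitrary: s)
  case (Seq c d)
  then show ?case using run_Seq[of "cost c" c s "cost d" d] by (simp add: bind_return_pmf)
next
  case (Cond b c d)
  have "run (max (cost c) (cost d)) (if bval b s then c else d, s) =
      return_pmf (Skip, exec (if bval b s then c else d) s)"
    using Cond run_halted[of "cost c" "(c, s)" "max (cost c) (cost d) - cost c"]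
      run_halted[of "cost d" "(d, s)" "max (cost c) (cost d) - cost d"] by auto
  then show ?case by (simp add: bind_return_pmf)
qed (auto simp: bind_return_pmf)

lemma yields_straight:
  assumes "straight c" "Q \<omega> (exec c s)" "cost c \<le> t"
  shows "yields c s t (return_pmf \<omega>) Q"
proof -
  have "yields c s (cost c) (return_pmf \<omega>) Q"
    using assms by (simp add: yields_def run_straight)
  from yields_mono[OF this assms(3)] show ?thesis by blast
qed

lemma yields_Flip:
  fixes W :: "bool \<Rightarrow> 'w pmf"
  assumes "\<And>b. yields d ((fst s)(v := of_bool b), snd s) t (W b) R"
  shows "yields (Seq (Flip v) d) s (1 + 1 + t) (bind_pmf (bernoulli_pmf (1 / 2)) W) R"
proof (rule yields_Seq)
  show "yields (Flip v) s 1 (bernoulli_pmf (1 / 2))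
      (\<lambda>b s'. s' = ((fst s)(v := of_bool b), snd s))"
    by (simp add: yields_def pmf.rel_map rel_pmf_reflI bind_map_pmf map_pmf_def[symmetric])
  show "yields d s' t (W b) R" if "s' = ((fst s)(v := of_bool b), snd s)" for b s'
    using assms that by blast
qed simp

section \<open>Loops\<close>

primrec iterate :: "nat \<Rightarrow> ('w \<Rightarrow> 'w pmf) \<Rightarrow> 'w \<Rightarrow> 'w pmf" where
  "iterate 0 K \<omega> = return_pmf \<omega>"
| "iterate (Suc n) K \<omega> = bind_pmf (K \<omega>) (iterate n K)"

lemma iterate_return: "iterate n return_pmf \<omega> = return_pmf \<omega>"
  by (induction n) (simp_all add: bind_return_pmf)

text \<open>Started from the empty list, \<open>n\<close> rounds of appending a fresh sample give
  \<open>n\<close> independent samples; this turns the sampling loop into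
  \<open>replicate_pmf\<close>.\<close>

lemma iterate_append:
  "iterate n (\<lambda>xs. map_pmf (\<lambda>x. xs @ [x]) W) xs = map_pmf (\<lambda>ys. xs @ ys) (replicate_pmf n W)"
  unfolding map_pmf_def
  by (induction n arbitrary: xs)
    (simp_all add: bind_assoc_pmf bind_return_pmf)

text \<open>The invariant is indexed by the number of finished rounds and by the ghost value. Each
  round costs three steps besides the body: \<open>While\<close> unfolds to \<open>Cond\<close>,
  \<open>Cond\<close> to \<open>Seq\<close>, and the halted body is dropped. The last two steps
  unfold the loop and leave it.\<close>

lemma yields_While:
  assumes "I 0 \<omega> s"
    and body: "\<And>i \<omega> s. i < n \<Longrightarrow> I i \<omega> s \<Longrightarrow> bval b s \<and> yields c s t (K \<omega>) (I (Suc i))"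
    and exit: "\<And>\<omega> s. I n \<omega> s \<Longrightarrow> \<not> bval b s"
    and "n * (t + 3) + 2 \<le> t'"
  shows "yields (While b c) s t' (iterate n K \<omega>) (I n)"
proof -
  have "yields (While b c) s (k * (t + 3) + 2) (iterate k K \<omega>) (I n)"
    if "I i \<omega> s" "i + k = n" for i k \<omega> s
    using that
  proof (induction k arbitrary: i \<omega> s)
    case 0
    then show ?case using exit[of \<omega> s] by (simp add: yields_def bind_return_pmf numeral_2_eq_2)
  next
    case (Suc k)
    from Suc.prems body[of i \<omega> s] have *: "bval b s" "yields c s t (K \<omega>) (I (Suc i))" by auto
    have "yields (Seq c (While b c)) s (t + 1 + (k * (t + 3) + 2)) (iterate (Suc k) K \<omega>) (I n)"
      unfolding iterate.simps by (rule yields_Seq[OF *(2) Suc.IH]) (use Suc.prems in auto)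
    moreover have "run (Suc (Suc u)) (While b c, s) = run u (Seq c (While b c), s)" for u
      using * by (simp add: bind_return_pmf)
    moreover have "Suc k * (t + 3) + 2 = Suc (Suc (t + 1 + (k * (t + 3) + 2)))"
      by (simp add: algebra_simps)
    ultimately show ?case by (simp only: yields_def)
  qed
  from yields_mono[OF this assms(4)] assms(1) show ?thesis by simp
qed

lemma yields_While_det:
  assumes "I 0 s"
    and "\<And>i s. i < n \<Longrightarrow> I i s \<Longrightarrow> bval b s \<and> yields c s t (return_pmf \<omega>) (\<lambda>_. I (Suc i))"
    and "\<And>s. I n s \<Longrightarrow> \<not> bval b s"
    and "n * (t + 3) + 2 \<le> t'"
  shows "yields (While b c) s t' (return_pmf \<omega>) (\<lambda>_. I n)"
proof -
  have "yields (While b c) s t' (iterate n return_pmf \<omega>) (\<lambda>\<omega>' s. \<omega>' = \<omega> \<and> I n s)"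
  proof (rule yields_While[where t = t])
    fix i \<omega>' s assume "i < n" "\<omega>' = \<omega> \<and> I i s"
    with assms(2)[of i s] show "bval b s \<and> yields c s t (return_pmf \<omega>') (\<lambda>\<omega>' s. \<omega>' = \<omega> \<and> I (Suc i) s)"
      by (auto elim: yields_mono)
  qed (use assms in auto)
  then show ?thesis unfolding iterate_return by (rule yields_mono) auto
qed

section \<open>The rounding program\<close>

type_synonym coins = "(bool \<times> bool \<times> bool) list"

definition greedy :: "coins \<Rightarrow> nat \<Rightarrow> bool" where
  "greedy \<omega> i \<longleftrightarrow> fst (\<omega> ! i)"

definition spin :: "coins \<Rightarrow> nat \<Rightarrow> int" where
  "spin \<omega> i = (if fst (snd (\<omega> ! i)) then -1 else 1)"

definition spin' :: "coins \<Rightarrow> nat \<Rightarrow> int" where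
  "spin' \<omega> i = (if snd (snd (\<omega> ! i)) then -1 else 1)"

text \<open>The discrete derivative of the predicate in direction \<open>j\<close>. It overwrites
  \<open>x j\<close>, so it does not change when the sign of \<open>j\<close> is negated; the
  symmetry arguments rest on this.\<close>

definition gain :: "cons \<Rightarrow> nat \<Rightarrow> (nat \<Rightarrow> int) \<Rightarrow> int" where
  "gain c j x = of_bool (pred c (map (x(j := 1)) (scope c)))
     - of_bool (pred c (map (x(j := -1)) (scope c)))"

definition active :: "cons \<Rightarrow> nat \<Rightarrow> coins \<Rightarrow> bool" where
  "active c j \<omega> \<longleftrightarrow> {i \<in> set (scope c). greedy \<omega> i} = {j}"

definition vote :: "cons \<Rightarrow> nat \<Rightarrow> coins \<Rightarrow> int" where
  "vote c j \<omega> = (if active c j \<omega> then gain c j (spin \<omega>) - gain c j (spin' \<omega>) else 0)"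

definition tally :: "csp \<Rightarrow> nat \<Rightarrow> coins \<Rightarrow> int" where
  "tally I j \<omega> = (\<Sum>l<ncons I. vote (constraints I ! l) j \<omega>)"

text \<open>The tie rule does two things: a variable that is not greedy, whose tally is 0, keeps its
  sign, and negating both the tally and the sign negates the output also in a tie.\<close>

definition rounded :: "csp \<Rightarrow> coins \<Rightarrow> nat \<Rightarrow> int" where
  "rounded I \<omega> j = (if tally I j \<omega> > 0 then 1 else if tally I j \<omega> < 0 then -1 else spin \<omega> j)"

definition toss :: "(bool \<times> bool \<times> bool) pmf" where
  "toss = bind_pmf (bernoulli_pmf (1 / 2)) (\<lambda>a. bind_pmf (bernoulli_pmf (1 / 2))
     (\<lambda>b. bind_pmf (bernoulli_pmf (1 / 2)) (\<lambda>c. return_pmf (a, b, c))))"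

section \<open>Program text and memory layout\<close>

abbreviation seq :: "com \<Rightarrow> com \<Rightarrow> com" (infixr ";;" 60) where
  "c ;; d \<equiv> Seq c d"

text \<open>Only sums and differences are available, so \<open>4 * e\<close> is written as two
  doublings. The four tables are interleaved: for \<open>k\<close> from 1 to 4 the addresses
  \<open>- k - 4 * v\<close> are negative, and they determine \<open>k\<close> modulo 4.\<close>

definition cell :: "int \<Rightarrow> aexp \<Rightarrow> aexp" where
  "cell k e = Minus (N (- k)) (Plus (Plus e e) (Plus e e))"

definition addr :: "int \<Rightarrow> int \<Rightarrow> int" where
  "addr k v = - k - 4 * v"

lemma aval_cell [simp]: "aval (cell k e) s = addr k (aval e s)"
  by (simp add: cell_def addr_def)

lemma addr_neq [simp]:
  "addr 1 v \<noteq> addr 2 w" "addr 1 v \<noteq> addr 3 w" "addr 1 v \<noteq> addr 4 w"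
  "addr 2 v \<noteq> addr 1 w" "addr 2 v \<noteq> addr 3 w" "addr 2 v \<noteq> addr 4 w"
  "addr 3 v \<noteq> addr 1 w" "addr 3 v \<noteq> addr 2 w" "addr 3 v \<noteq> addr 4 w"
  "addr 4 v \<noteq> addr 1 w" "addr 4 v \<noteq> addr 2 w" "addr 4 v \<noteq> addr 3 w"
  unfolding addr_def by presburger+

lemma addr_eq_iff [simp]: "addr k v = addr k w \<longleftrightarrow> v = w"
  by (simp add: addr_def)

lemma addr_neg [simp]: "0 < k \<Longrightarrow> addr k (int v) < 0"
  by (simp add: addr_def)

lemma addr_neq_int [simp]: "0 < k \<Longrightarrow> addr k (int v) \<noteq> int a" "0 < k \<Longrightarrow> int a \<noteq> addr k (int v)"
  by (auto simp: addr_def)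

definition sample_body :: com where
  "sample_body =
     Flip ''a'' ;; Flip ''b'' ;; Flip ''c'' ;;
     Store (cell 1 (V ''i'')) (V ''a'') ;;
     Store (cell 2 (V ''i'')) (V ''b'') ;;
     Store (cell 3 (V ''i'')) (V ''c'') ;;
     Assign ''i'' (Plus (V ''i'') (N 1))"

text \<open>Here \<open>p\<close> is the address of the arity, \<open>w\<close> is
  \<open>2 ^ t\<close>, and \<open>c\<close> counts greedy variables. \<open>j\<close> and
  \<open>u\<close> hold the latest greedy variable and its weight. \<open>e\<close> and
  \<open>f\<close> collect the truth-table indices of \<open>y\<close> and \<open>y'\<close>, with
  bit 0 at greedy positions.\<close>

definition scan_body :: com where
  "scan_body =
     Assign ''v'' (Load (Plus (Plus (V ''p'') (N 1)) (V ''t''))) ;;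
     Cond (Less (N 0) (Load (cell 1 (V ''v''))))
       (Assign ''c'' (Plus (V ''c'') (N 1)) ;;
        Assign ''j'' (V ''v'') ;;
        Assign ''u'' (V ''w''))
       (Cond (Less (N 0) (Load (cell 2 (V ''v''))))
          (Assign ''e'' (Plus (V ''e'') (V ''w''))) Skip ;;
        Cond (Less (N 0) (Load (cell 3 (V ''v''))))
          (Assign ''f'' (Plus (V ''f'') (V ''w''))) Skip) ;;
     Assign ''w'' (Plus (V ''w'') (V ''w'')) ;;
     Assign ''t'' (Plus (V ''t'') (N 1))"

definition scan_init :: com where
  "scan_init =
     Assign ''r'' (Load (V ''p'')) ;; Assign ''t'' (N 0) ;; Assign ''w'' (N 1) ;;
     Assign ''c'' (N 0) ;; Assign ''e'' (N 0) ;; Assign ''f'' (N 0)"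

text \<open>First \<open>p\<close> moves to the truth table. Entry \<open>e\<close> is the value for
  \<open>y\<close> with \<open>j\<close> set to 1, since the bit of \<open>j\<close> is clear, and
  entry \<open>e + u\<close> that with \<open>j\<close> set to -1; likewise for \<open>f\<close> and
  \<open>y'\<close>. After the scan \<open>w\<close> is the length of the table, which takes
  \<open>p\<close> to the next constraint.\<close>

definition vote_update :: com where
  "vote_update =
     Assign ''p'' (Plus (Plus (V ''p'') (N 1)) (V ''r'')) ;;
     Cond (BAnd (Less (N 0) (V ''c'')) (Less (V ''c'') (N 2)))
       (Store (cell 4 (V ''j''))
          (Plus (Load (cell 4 (V ''j'')))
            (Minus
              (Minus (Load (Plus (V ''p'') (V ''e'')))
                     (Load (Plus (Plus (V ''p'') (V ''e'')) (V ''u''))))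
              (Minus (Load (Plus (V ''p'') (V ''f'')))
                     (Load (Plus (Plus (V ''p'') (V ''f'')) (V ''u'')))))))
       Skip ;;
     Assign ''p'' (Plus (V ''p'') (V ''w'')) ;;
     Assign ''l'' (Plus (V ''l'') (N 1))"

definition vote_body :: com where
  "vote_body = scan_init ;; While (Less (V ''t'') (V ''r'')) scan_body ;; vote_update"

text \<open>The outputs overwrite input cells, which have been read completely by then; tallies and
  coins lie at negative addresses.\<close>

definition round_body :: com where
  "round_body =
     Cond (Less (N 0) (Load (cell 4 (V ''i''))))
       (Store (V ''i'') (N 1))
       (Cond (Less (Load (cell 4 (V ''i''))) (N 0))
          (Store (V ''i'') (N (-1)))
          (Cond (Less (N 0) (Load (cell 2 (V ''i''))))
             (Store (V ''i'') (N (-1)))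
             (Store (V ''i'') (N 1)))) ;;
     Assign ''i'' (Plus (V ''i'') (N 1))"

text \<open>Registers are initially 0, so the first loop over \<open>i\<close> and the loop over
  \<open>l\<close> start without an assignment.\<close>

definition rounding :: com where
  "rounding =
     (Assign ''n'' (Load (N 0)) ;; Assign ''m'' (Load (N 1))) ;;
     While (Less (V ''i'') (V ''n'')) sample_body ;;
     Assign ''p'' (N 2) ;;
     While (Less (V ''l'') (V ''m'')) vote_body ;;
     Assign ''i'' (N 0) ;;
     While (Less (V ''i'') (V ''n'')) round_body"

text \<open>Cells 1, 2, 3 of a variable hold its three coins (is it greedy; is its first, its second sign
  negative), cell 4 holds its tally. They lie at negative addresses, clear of input and output.\<close>

definition stored :: "int list \<Rightarrow> coins \<Rightarrow> (nat \<Rightarrow> int) \<Rightarrow> (int \<Rightarrow> int) \<Rightarrow> bool" where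
  "stored xs \<omega> Z \<mu> \<longleftrightarrow>
     (\<forall>a<length xs. \<mu> (int a) = xs ! a) \<and>
     (\<forall>v<length \<omega>. \<mu> (addr 1 (int v)) = of_bool (fst (\<omega> ! v)) \<and>
        \<mu> (addr 2 (int v)) = of_bool (fst (snd (\<omega> ! v))) \<and>
        \<mu> (addr 3 (int v)) = of_bool (snd (snd (\<omega> ! v)))) \<and>
     (\<forall>v. \<mu> (addr 4 (int v)) = Z v)"

definition sample_inv :: "int list \<Rightarrow> nat \<Rightarrow> nat \<Rightarrow> nat \<Rightarrow> coins \<Rightarrow> state \<Rightarrow> bool" where
  "sample_inv xs n m i \<omega> s \<longleftrightarrow>
     length \<omega> = i \<and> fst s ''i'' = int i \<and> fst s ''n'' = int n \<and> fst s ''m'' = int m \<and>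
     fst s ''l'' = 0 \<and> stored xs \<omega> (\<lambda>_. 0) (snd s)"

lemma sample_body_correct:
  assumes "sample_inv xs n m i \<omega> s"
  shows "yields sample_body s 13 (map_pmf (\<lambda>x. \<omega> @ [x]) toss) (sample_inv xs n m (Suc i))"
proof -
  define rest where "rest =
     Store (cell 1 (V ''i'')) (V ''a'') ;;
     Store (cell 2 (V ''i'')) (V ''b'') ;;
     Store (cell 3 (V ''i'')) (V ''c'') ;;
     Assign ''i'' (Plus (V ''i'') (N 1))"
  have "yields (Flip ''a'' ;; Flip ''b'' ;; Flip ''c'' ;; rest) s (1 + 1 + (1 + 1 + (1 + 1 + 7)))
     (bind_pmf (bernoulli_pmf (1 / 2)) (\<lambda>a. bind_pmf (bernoulli_pmf (1 / 2))
     (\<lambda>b. bind_pmf (bernoulli_pmf (1 / 2)) (\<lambda>c. return_pmf (\<omega> @ [(a, b, c)])))))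
     (sample_inv xs n m (Suc i))"
  proof (intro yields_Flip yields_straight)
    fix a b c
    show "sample_inv xs n m (Suc i) (\<omega> @ [(a, b, c)])
       (exec rest ((fst ((fst ((fst s)(''a'' := of_bool a), snd s))(''b'' := of_bool b),
          snd ((fst s)(''a'' := of_bool a), snd s)))(''c'' := of_bool c),
          snd ((fst ((fst s)(''a'' := of_bool a), snd s))(''b'' := of_bool b),
            snd ((fst s)(''a'' := of_bool a), snd s))))"
      using assms unfolding sample_inv_def stored_def rest_def
      by (auto simp: nth_append less_Suc_eq)
  qed (simp_all add: rest_def)
  moreover have "map_pmf (\<lambda>x. \<omega> @ [x]) toss =
     bind_pmf (bernoulli_pmf (1 / 2)) (\<lambda>a. bind_pmf (bernoulli_pmf (1 / 2))
     (\<lambda>b. bind_pmf (bernoulli_pmf (1 / 2)) (\<lambda>c. return_pmf (\<omega> @ [(a, b, c)]))))"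
    unfolding toss_def map_bind_pmf map_return_pmf ..
  ultimately show ?thesis
    unfolding sample_body_def rest_def by simp
qed


section \<open>Input layout and truth-table indices\<close>

definition offset :: "csp \<Rightarrow> nat \<Rightarrow> nat" where
  "offset I l = 2 + length (concat (map encode_cons (take l (constraints I))))"

lemma length_encode_cons: "length (encode_cons c) = 1 + arity c + 2 ^ arity c"
  by (simp add: encode_cons_def truth_table_def)

lemma offset_Suc: "l < ncons I \<Longrightarrow> offset I (Suc l) = offset I l + 1 + arity (constraints I ! l) + 2 ^ arity (constraints I ! l)"
  by (simp add: offset_def take_Suc_conv_app_nth length_encode_cons)

lemma encode_csp_nth:
  assumes "l < ncons I" "q < length (encode_cons (constraints I ! l))"
  shows "offset I l + q < length (encode_csp I)"
    and "encode_csp I ! (offset I l + q) = encode_cons (constraints I ! l) ! q"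
proof -
  define pre post where
    "pre = int (nvars I) # int (ncons I) # concat (map encode_cons (take l (constraints I)))"
    and "post = concat (map encode_cons (drop (Suc l) (constraints I)))"
  have "encode_csp I = pre @ encode_cons (constraints I ! l) @ post"
    unfolding encode_csp_def pre_def post_def
    by (subst id_take_nth_drop[OF assms(1)]) simp
  moreover have "offset I l = length pre" by (simp add: offset_def pre_def)
  ultimately show "offset I l + q < length (encode_csp I)"
    "encode_csp I ! (offset I l + q) = encode_cons (constraints I ! l) ! q"
    using assms(2) by (simp_all add: nth_append)
qed

definition bits_value :: "(nat \<Rightarrow> bool) \<Rightarrow> nat \<Rightarrow> nat" where
  "bits_value f r = (\<Sum>t<r. of_bool (f t) * 2 ^ t)"

lemma bits_value_Suc: "bits_value f (Suc r) = bits_value f r + of_bool (f r) * 2 ^ r"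
  by (simp add: bits_value_def)

lemma bits_value_less: "bits_value f r < 2 ^ r"
  by (induction r) (auto simp: bits_value_Suc bits_value_def)

lemma bit_bits_value: "bit (bits_value f r) t \<longleftrightarrow> t < r \<and> f t"
proof -
  have "bits_value f r = horner_sum of_bool 2 (map f [0..<r])"
    by (simp add: bits_value_def horner_sum_eq_sum lessThan_atLeast0)
  then show ?thesis by (auto simp: bit_horner_sum_bit_iff)
qed

text \<open>Setting a clear bit adds its weight without a carry.\<close>

lemma bits_value_insert:
  assumes "q < r" "\<not> f q"
  shows "bits_value (f(q := True)) r = bits_value f r + 2 ^ q"
proof -
  have "bits_value (f(q := True)) r = (\<Sum>t<r. of_bool (f t) * 2 ^ t + (if t = q then 2 ^ q else 0))"
    unfolding bits_value_def using assms(2) by (intro sum.cong) auto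
  also have "\<dots> = bits_value f r + 2 ^ q"
    using assms(1) by (simp add: sum.distrib bits_value_def)
  finally show ?thesis .
qed

lemma truth_table_bits_value:
  "truth_table r P ! bits_value f r = of_bool (P (map (\<lambda>i. if f i then -1 else 1) [0..<r]))"
proof -
  have "map (\<lambda>i. if bit (bits_value f r) i then -1 else 1) [0..<r] = map (\<lambda>i. if f i then -1 else 1 :: int) [0..<r]"
    by (simp add: bit_bits_value)
  then show ?thesis by (simp only: truth_table_def) (simp add: bits_value_less del: map_eq_conv)
qed

text \<open>Position \<open>q\<close> has its bit clear in \<open>f\<close>, which stands for the
  value 1; the table entry \<open>2 ^ q\<close> further on has the value -1 there. At the other
  positions \<open>f\<close> records the signs of \<open>x\<close>, and since the scope is distinct,
  changing \<open>x\<close> at this variable affects no other position.\<close>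

lemma gain_truth_table:
  assumes "distinct (scope c)" "q < arity c"
    and f: "\<And>t. t < arity c \<Longrightarrow> t \<noteq> q \<Longrightarrow> x (scope c ! t) = (if f t then -1 else 1)" "\<not> f q"
  shows "gain c (scope c ! q) x =
    truth_table (arity c) (pred c) ! bits_value f (arity c)
     - truth_table (arity c) (pred c) ! (bits_value f (arity c) + 2 ^ q)"
proof -
  have "map (x(scope c ! q := 1)) (scope c) = map (\<lambda>i. if f i then -1 else 1) [0..<arity c]"
    using assms by (auto intro!: nth_equalityI simp: nth_eq_iff_index_eq)
  moreover have "map (x(scope c ! q := -1)) (scope c) =
      map (\<lambda>i. if (f(q := True)) i then -1 else 1) [0..<arity c]"
    using assms by (auto intro!: nth_equalityI simp: nth_eq_iff_index_eq)
  ultimately show ?thesis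
    by (simp only: gain_def truth_table_bits_value bits_value_insert[where f = f, OF assms(2) f(2), symmetric])
qed

section \<open>Correctness of the voting and rounding loops\<close>

definition scan_inv :: "coins \<Rightarrow> cons \<Rightarrow> (int \<Rightarrow> int) \<Rightarrow> (string \<Rightarrow> int) \<Rightarrow> nat \<Rightarrow> state \<Rightarrow> bool" where
  "scan_inv \<omega> c \<mu> \<rho> i s \<longleftrightarrow>
     snd s = \<mu> \<and> (\<forall>v\<in>{''l'', ''m'', ''n'', ''p''}. fst s v = \<rho> v) \<and>
     fst s ''r'' = int (arity c) \<and> fst s ''t'' = int i \<and> fst s ''w'' = 2 ^ i \<and>
     fst s ''c'' = (\<Sum>t<i. of_bool (greedy \<omega> (scope c ! t))) \<and>
     fst s ''e'' = int (bits_value (\<lambda>t. \<not> greedy \<omega> (scope c ! t) \<and> spin \<omega> (scope c ! t) = -1) i) \<and>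
     fst s ''f'' = int (bits_value (\<lambda>t. \<not> greedy \<omega> (scope c ! t) \<and> spin' \<omega> (scope c ! t) = -1) i) \<and>
     (fst s ''c'' > 0 \<longrightarrow> (\<exists>q<i. greedy \<omega> (scope c ! q) \<and> fst s ''j'' = int (scope c ! q) \<and> fst s ''u'' = 2 ^ q))"

text \<open>In \<open>scan_inv\<close>, \<open>\<mu>\<close> and \<open>\<rho>\<close> fix the
  memory and the registers that a scan must preserve. All greedy positions have bit 0, and the last
  conjunct names some greedy position. The indices are used only when the count is 1, and then that
  position is the only one.\<close>

lemma scan_body_correct:
  assumes inv: "scan_inv \<omega> c \<mu> \<rho> i s" and i: "i < arity c"
    and \<mu>: "stored xs \<omega> Z \<mu>" "\<mu> (\<rho> ''p'' + 1 + int i) = int (scope c ! i)"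
    and sc: "set (scope c) \<subseteq> {..<length \<omega>}"
  shows "yields scan_body s 12 (return_pmf \<omega>') (\<lambda>_. scan_inv \<omega> c \<mu> \<rho> (Suc i))"
proof (rule yields_straight)
  define v where "v = scope c ! i"
  have "v < length \<omega>" using sc i unfolding v_def by force
  with \<mu>(1) have cells: "\<mu> (addr 1 (int v)) = of_bool (greedy \<omega> v)"
    "\<mu> (addr 2 (int v)) = of_bool (spin \<omega> v = -1)"
    "\<mu> (addr 3 (int v)) = of_bool (spin' \<omega> v = -1)"
    by (auto simp: stored_def greedy_def spin_def spin'_def)
  have load: "\<mu> (\<rho> ''p'' + 1 + int i) = int v" using \<mu>(2) by (simp add: v_def)
  define e f where "e = (\<lambda>t. \<not> greedy \<omega> (scope c ! t) \<and> spin \<omega> (scope c ! t) = -1)"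
    and "f = (\<lambda>t. \<not> greedy \<omega> (scope c ! t) \<and> spin' \<omega> (scope c ! t) = -1)"
  define C where "C = (\<Sum>t<i. of_bool (greedy \<omega> (scope c ! t)) :: int)"
  have regs: "snd s = \<mu>" "fst s ''l'' = \<rho> ''l''" "fst s ''m'' = \<rho> ''m''" "fst s ''n'' = \<rho> ''n''"
    "fst s ''p'' = \<rho> ''p''" "fst s ''r'' = int (arity c)" "fst s ''t'' = int i" "fst s ''w'' = 2 ^ i"
    "fst s ''c'' = C" "fst s ''e'' = int (bits_value e i)" "fst s ''f'' = int (bits_value f i)"
    and q_ex: "C > 0 \<Longrightarrow> \<exists>q<i. greedy \<omega> (scope c ! q) \<and> fst s ''j'' = int (scope c ! q) \<and> fst s ''u'' = 2 ^ q"
    using inv unfolding scan_inv_def C_def e_def f_def by auto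
  show "scan_inv \<omega> c \<mu> \<rho> (Suc i) (exec scan_body s)"
  proof (cases "greedy \<omega> v")
    case True
    have "exec scan_body s = ((fst s)(''v'' := int v, ''c'' := C + 1, ''j'' := int v, ''u'' := 2 ^ i,
        ''w'' := 2 ^ i + 2 ^ i, ''t'' := int i + 1), \<mu>)"
      by (simp add: scan_body_def regs load cells True)
    moreover have "\<exists>q<Suc i. greedy \<omega> (scope c ! q) \<and> int v = int (scope c ! q) \<and> (2 :: int) ^ i = 2 ^ q"
      using True by (auto simp: v_def)
    ultimately show ?thesis
      using True by (simp add: scan_inv_def regs bits_value_Suc C_def e_def f_def flip: v_def)
  next
    case False
    have "exec scan_body s = ((fst s)(''v'' := int v, ''e'' := int (bits_value e (Suc i)), ''f'' := int (bits_value f (Suc i)),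
        ''w'' := 2 ^ i + 2 ^ i, ''t'' := int i + 1), \<mu>)"
      by (auto simp add: scan_body_def regs load cells False bits_value_Suc e_def f_def fun_eq_iff simp flip: v_def)
    moreover have "\<exists>q<Suc i. greedy \<omega> (scope c ! q) \<and> fst s ''j'' = int (scope c ! q) \<and> fst s ''u'' = 2 ^ q" if "C > 0"
      using q_ex[OF that] less_SucI by blast
    ultimately show ?thesis
      using False by (simp add: scan_inv_def regs C_def e_def f_def flip: v_def)
  qed
  show "straight scan_body" by (simp add: scan_body_def)
  show "cost scan_body \<le> 12" by (simp add: scan_body_def)
qed

definition vote_inv :: "csp \<Rightarrow> coins \<Rightarrow> nat \<Rightarrow> state \<Rightarrow> bool" where
  "vote_inv I \<omega> l s \<longleftrightarrow>
     fst s ''l'' = int l \<and> fst s ''m'' = int (ncons I) \<and> fst s ''n'' = int (nvars I) \<and>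
     fst s ''p'' = int (offset I l) \<and>
     stored (encode_csp I) \<omega> (\<lambda>j. \<Sum>l'<l. vote (constraints I ! l') j \<omega>) (snd s)"

lemma sum_of_bool_1_iff:
  "(\<Sum>t<(r::nat). of_bool (g t) :: int) = 1 \<longleftrightarrow> (\<exists>q<r. \<forall>t<r. g t \<longleftrightarrow> t = q)"
proof -
  have "(\<Sum>t<r. of_bool (g t) :: int) = int (card {t. t < r \<and> g t})"
    by (subst sum_of_bool_eq) (simp_all add: Int_def)
  moreover have "card {t. t < r \<and> g t} = 1 \<longleftrightarrow> (\<exists>q<r. \<forall>t<r. g t \<longleftrightarrow> t = q)"
  proof -
    have "{t. t < r \<and> g t} = {q} \<longleftrightarrow> q < r \<and> (\<forall>t<r. g t \<longleftrightarrow> t = q)" for q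
      by blast
    then show ?thesis unfolding One_nat_def card_1_singleton_iff by metis
  qed
  ultimately show ?thesis by simp
qed

text \<open>The program counts positions while \<open>active\<close> speaks of variables; for a
  scope without repetition the two agree.\<close>

lemma active_iff:
  assumes "distinct (scope c)"
  shows "active c j \<omega> \<longleftrightarrow> (\<exists>q<arity c. j = scope c ! q \<and> (\<forall>t<arity c. greedy \<omega> (scope c ! t) \<longleftrightarrow> t = q))"
proof
  assume a: "active c j \<omega>"
  then have "j \<in> set (scope c)" unfolding active_def by blast
  then obtain q where q: "q < arity c" "scope c ! q = j" unfolding in_set_conv_nth by blast
  have "greedy \<omega> (scope c ! t) \<longleftrightarrow> scope c ! t = j" if "t < arity c" for t
    using a nth_mem[OF that] unfolding active_def by blast
  with q show "\<exists>q<arity c. j = scope c ! q \<and> (\<forall>t<arity c. greedy \<omega> (scope c ! t) \<longleftrightarrow> t = q)"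
    using assms nth_eq_iff_index_eq by metis
next
  assume "\<exists>q<arity c. j = scope c ! q \<and> (\<forall>t<arity c. greedy \<omega> (scope c ! t) \<longleftrightarrow> t = q)"
  then obtain q where q: "q < arity c" "j = scope c ! q"
    "\<And>t. t < arity c \<Longrightarrow> greedy \<omega> (scope c ! t) \<longleftrightarrow> t = q" by blast
  have "i = j" if "i \<in> set (scope c)" "greedy \<omega> i" for i
  proof -
    from that(1) obtain t where "t < arity c" "scope c ! t = i" unfolding in_set_conv_nth by blast
    with that(2) q show ?thesis by blast
  qed
  moreover have "j \<in> set (scope c)" "greedy \<omega> j" using q by auto
  ultimately show "active c j \<omega>" unfolding active_def by blast
qed

text \<open>When the count is 1, the scan has recorded the unique greedy position, and the four
  table entries read are those of \<open>gain_truth_table\<close>. Otherwise the constraint is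
  active for no variable and no tally changes.\<close>

lemma vote_update_correct:
  assumes I: "valid_csp I" "l < ncons I" "length \<omega> = nvars I"
    and c: "c = constraints I ! l"
    and inv: "scan_inv \<omega> c \<mu> \<rho> (arity c) s"
    and \<mu>: "stored (encode_csp I) \<omega> (\<lambda>j. \<Sum>l'<l. vote (constraints I ! l') j \<omega>) \<mu>"
    and \<rho>: "\<rho> ''p'' = int (offset I l)" "\<rho> ''l'' = int l" "\<rho> ''m'' = int (ncons I)" "\<rho> ''n'' = int (nvars I)"
  shows "vote_inv I \<omega> (Suc l) (exec vote_update s)"
proof -
  define p where "p = offset I l + 1 + arity c"
  define T where "T = truth_table (arity c) (pred c)"
  define g where "g t = greedy \<omega> (scope c ! t)" for t
  define e f where "e = bits_value (\<lambda>t. \<not> g t \<and> spin \<omega> (scope c ! t) = -1) (arity c)"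
    and "f = bits_value (\<lambda>t. \<not> g t \<and> spin' \<omega> (scope c ! t) = -1) (arity c)"
  define cnt where "cnt = (\<Sum>t<arity c. of_bool (g t) :: int)"
  have "c \<in> set (constraints I)" using I(2) c by simp
  with I(1) have dist: "distinct (scope c)" and sub: "set (scope c) \<subseteq> {..<length \<omega>}"
    using I(3) by (auto simp: valid_csp_def)
  have table: "\<mu> (int p + int q) = T ! q" if "q < 2 ^ arity c" for q
  proof -
    have "p + q = offset I l + (1 + arity c + q)" by (simp add: p_def)
    moreover have "encode_cons c ! (1 + arity c + q) = T ! q"
      by (simp add: encode_cons_def nth_append T_def)
    ultimately have "p + q < length (encode_csp I)" "encode_csp I ! (p + q) = T ! q"
      using encode_csp_nth[OF I(2), of "1 + arity c + q", folded c] that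
      by (simp_all only: length_encode_cons)
    moreover have "int p + int q = int (p + q)" by simp
    ultimately show ?thesis using \<mu> unfolding stored_def by metis
  qed
  have regs: "fst s ''r'' = int (arity c)" "fst s ''c'' = cnt" "fst s ''e'' = int e" "fst s ''f'' = int f"
    "fst s ''w'' = 2 ^ arity c" "snd s = \<mu>" "fst s ''p'' = int (offset I l)" "fst s ''l'' = int l"
    "fst s ''m'' = int (ncons I)" "fst s ''n'' = int (nvars I)"
    and q_ex: "cnt > 0 \<Longrightarrow> \<exists>q<arity c. g q \<and> fst s ''j'' = int (scope c ! q) \<and> fst s ''u'' = 2 ^ q"
    using inv \<rho> unfolding scan_inv_def cnt_def g_def e_def f_def by auto
  have offset': "int (offset I (Suc l)) = int p + 2 ^ arity c"
    using offset_Suc[OF I(2)] c by (simp add: p_def)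
  show ?thesis
  proof (cases "cnt = 1")
    case True
    then obtain q where q: "q < arity c" "g q" "fst s ''j'' = int (scope c ! q)" "fst s ''u'' = 2 ^ q"
      using q_ex by auto
    from True have uniq: "\<And>t. t < arity c \<Longrightarrow> g t \<longleftrightarrow> t = q"
      unfolding cnt_def sum_of_bool_1_iff using q by blast
    define j where "j = scope c ! q"
    have act: "active c j' \<omega> \<longleftrightarrow> j' = j" for j'
      unfolding active_iff[OF dist] j_def using uniq q(1,2) unfolding g_def by blast
    \<comment> \<open>Each sum is the index of the same bit pattern with bit \<open>q\<close> set,
      hence still within the table.\<close>
    have less: "e + 2 ^ q < 2 ^ arity c" "f + 2 ^ q < 2 ^ arity c" "e < 2 ^ arity c" "f < 2 ^ arity c"
      using bits_value_less bits_value_insert[OF q(1)] q(2) unfolding e_def f_def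
      by (metis (no_types, lifting))+
    have "gain c j (spin \<omega>) = T ! e - T ! (e + 2 ^ q)"
      unfolding j_def T_def e_def using uniq q by (intro gain_truth_table[OF dist]) (auto simp: spin_def)
    moreover have "gain c j (spin' \<omega>) = T ! f - T ! (f + 2 ^ q)"
      unfolding j_def T_def f_def using uniq q by (intro gain_truth_table[OF dist]) (auto simp: spin'_def)
    ultimately have vote: "vote c j' \<omega> =
        (if j' = j then (T ! e - T ! (e + 2 ^ q)) - (T ! f - T ! (f + 2 ^ q)) else 0)" for j'
      by (simp add: vote_def act)
    have tab: "\<mu> (int p + int e) = T ! e" "\<mu> (int p + int e + 2 ^ q) = T ! (e + 2 ^ q)"
       "\<mu> (int p + int f) = T ! f" "\<mu> (int p + int f + 2 ^ q) = T ! (f + 2 ^ q)"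
      using table[OF less(1)] table[OF less(2)] table[OF less(3)] table[OF less(4)] by (simp_all add: add_ac)
    define z where "z = \<mu> (addr 4 (int j)) + (T ! e - T ! (e + 2 ^ q) - (T ! f - T ! (f + 2 ^ q)))"
    have p': "int (offset I l) + 1 + int (arity c) = int p" by (simp add: p_def)
    have ex: "exec vote_update s = ((fst s)(''p'' := int p + 2 ^ arity c, ''l'' := int l + 1), \<mu>(addr 4 (int j) := z))"
      using regs q True by (simp add: vote_update_def z_def p' tab j_def fun_eq_iff)
    have "stored (encode_csp I) \<omega> (\<lambda>j. \<Sum>l'<Suc l. vote (constraints I ! l') j \<omega>) (\<mu>(addr 4 (int j) := z))"
      using \<mu> unfolding stored_def by (auto simp: z_def vote[unfolded c] c)
    then show ?thesis unfolding ex vote_inv_def using regs offset' by simp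
  next
    case False
    have "\<not> active c j' \<omega>" for j'
      using False unfolding active_iff[OF dist] cnt_def sum_of_bool_1_iff g_def by blast
    then have vote: "vote c j' \<omega> = 0" for j' by (simp add: vote_def)
    have "exec vote_update s = ((fst s)(''p'' := int p + 2 ^ arity c, ''l'' := int l + 1), \<mu>)"
      using regs False by (auto simp: vote_update_def p_def fun_eq_iff)
    then show ?thesis unfolding vote_inv_def using regs offset' \<mu> vote by (simp add: c)
  qed
qed

text \<open>A scope position costs 12 steps for the body and 3 for the loop. The bound
  \<open>k\<close> in place of the actual arity gives one budget for all constraints.\<close>

lemma vote_body_correct:
  assumes I: "valid_csp I" "l < ncons I" "length \<omega> = nvars I"
    and k: "arity (constraints I ! l) \<le> k" and inv: "vote_inv I \<omega> l s"
  shows "yields vote_body s (15 * k + 23) (return_pmf \<omega>') (\<lambda>_. vote_inv I \<omega> (Suc l))"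
  unfolding vote_body_def
proof (rule yields_Seq_init[where t = 11 and u = "15 * k + 11"])
  define c where "c = constraints I ! l"
  have "c \<in> set (constraints I)" using I(2) by (simp add: c_def)
  with I(1,3) have sub: "set (scope c) \<subseteq> {..<length \<omega>}" by (auto simp: valid_csp_def)
  have inv': "fst s ''p'' = int (offset I l)" "fst s ''l'' = int l" "fst s ''m'' = int (ncons I)" "fst s ''n'' = int (nvars I)"
    "stored (encode_csp I) \<omega> (\<lambda>j. \<Sum>l'<l. vote (constraints I ! l') j \<omega>) (snd s)"
    using inv by (simp_all add: vote_inv_def)
  have mem: "snd s (int (offset I l) + int q) = encode_cons c ! q" if "q < length (encode_cons c)" for q
    using inv'(5) encode_csp_nth[OF I(2), of q] that unfolding stored_def c_def by (metis of_nat_add)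
  show "yields scan_init s 11 (return_pmf \<omega>') (\<lambda>_. scan_inv \<omega> c (snd s) (fst s) 0)"
  proof (rule yields_straight)
    have "snd s (int (offset I l)) = int (arity c)"
      using mem[of 0] by (simp add: encode_cons_def)
    then show "scan_inv \<omega> c (snd s) (fst s) 0 (exec scan_init s)"
      by (simp add: scan_init_def scan_inv_def inv' bits_value_def)
  qed (simp_all add: scan_init_def)
  fix s1 assume s1: "scan_inv \<omega> c (snd s) (fst s) 0 s1"
  show "yields (While (Less (V ''t'') (V ''r'')) scan_body ;; vote_update) s1 (15 * k + 11)
     (return_pmf \<omega>') (\<lambda>_. vote_inv I \<omega> (Suc l))"
  proof (rule yields_Seq_init[where t = "15 * k + 2" and u = 8])
    show "yields (While (Less (V ''t'') (V ''r'')) scan_body) s1 (15 * k + 2) (return_pmf \<omega>')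
       (\<lambda>_. scan_inv \<omega> c (snd s) (fst s) (arity c))"
    proof (rule yields_While_det[where t = 12])
      fix i s2 assume i: "i < arity c" and s2: "scan_inv \<omega> c (snd s) (fst s) i s2"
      have "snd s (fst s ''p'' + 1 + int i) = int (scope c ! i)"
        using mem[of "1 + i"] i by (simp add: encode_cons_def nth_append inv' add_ac)
      from scan_body_correct[OF s2 i inv'(5) this sub]
      show "bval (Less (V ''t'') (V ''r'')) s2 \<and>
        yields scan_body s2 12 (return_pmf \<omega>') (\<lambda>_. scan_inv \<omega> c (snd s) (fst s) (Suc i))"
        using s2 i by (simp add: scan_inv_def)
    qed (use s1 k in \<open>auto simp: scan_inv_def c_def\<close>)
    fix s3 assume s3: "scan_inv \<omega> c (snd s) (fst s) (arity c) s3"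
    show "yields vote_update s3 8 (return_pmf \<omega>') (\<lambda>_. vote_inv I \<omega> (Suc l))"
      using vote_update_correct[OF I c_def s3 inv'(5,1,2,3,4)]
      by (intro yields_straight) (simp_all add: vote_update_def)
  qed simp
qed simp

definition round_inv :: "csp \<Rightarrow> coins \<Rightarrow> nat \<Rightarrow> state \<Rightarrow> bool" where
  "round_inv I \<omega> i s \<longleftrightarrow>
     fst s ''i'' = int i \<and> fst s ''n'' = int (nvars I) \<and>
     (\<forall>v<i. snd s (int v) = rounded I \<omega> v) \<and>
     (\<forall>v<nvars I. snd s (addr 4 (int v)) = tally I v \<omega> \<and>
        snd s (addr 2 (int v)) = of_bool (spin \<omega> v = -1))"

lemma round_body_correct:
  assumes "round_inv I \<omega> i s" "i < nvars I"
  shows "yields round_body s 6 (return_pmf \<omega>') (\<lambda>_. round_inv I \<omega> (Suc i))"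
proof (rule yields_straight)
  have regs: "fst s ''i'' = int i" "snd s (addr 4 (int i)) = tally I i \<omega>"
    "snd s (addr 2 (int i)) = of_bool (spin \<omega> i = -1)"
    using assms by (simp_all add: round_inv_def)
  have "exec round_body s = ((fst s)(''i'' := int i + 1), (snd s)(int i := rounded I \<omega> i))"
    by (simp add: round_body_def regs rounded_def spin_def)
  then show "round_inv I \<omega> (Suc i) (exec round_body s)"
    using assms by (simp add: round_inv_def less_Suc_eq)
qed (simp_all add: round_body_def)

lemma init_state_inv:
  "sample_inv (encode_csp I) (nvars I) (ncons I) 0 []
    (exec (Assign ''n'' (Load (N 0)) ;; Assign ''m'' (Load (N 1))) (init_state (encode_csp I)))"
proof -
  have "addr 4 (int v) < 0" for v by simp
  then have "\<not> 0 \<le> addr 4 (int v)" for v using not_le by blast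
  moreover have "encode_csp I ! 0 = int (nvars I)" "encode_csp I ! 1 = int (ncons I)"
    "length (encode_csp I) > 1" "encode_csp I \<noteq> []" by (simp_all add: encode_csp_def)
  ultimately show ?thesis
    by (simp add: sample_inv_def stored_def init_state_def)
qed

text \<open>With 3 steps of overhead each, a round takes 16 steps when sampling,
  \<open>15 * k + 26\<close> when voting and 9 when writing the output. The ghost value is the whole
  table of coins, so on the variables the output is a function of a sample from
  \<open>replicate_pmf (nvars I) toss\<close>.\<close>

lemma rounding_correct:
  assumes "valid_csp I" "\<forall>c\<in>set (constraints I). arity c \<le> k"
  shows "yields rounding (init_state (encode_csp I)) (25 * nvars I + ncons I * (15 * k + 26) + 16)
    (replicate_pmf (nvars I) toss) (\<lambda>\<omega> s. \<forall>i<nvars I. snd s (int i) = rounded I \<omega> i)"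
proof -
  define n m where "n = nvars I" and "m = ncons I"
  let ?xs = "encode_csp I"
  have loop3: "yields (Assign ''i'' (N 0) ;; While (Less (V ''i'') (V ''n'')) round_body) s (9 * n + 4)
      (return_pmf \<omega>) (\<lambda>\<omega> s. \<forall>i<nvars I. snd s (int i) = rounded I \<omega> i)"
    if inv: "vote_inv I \<omega> m s" and len: "length \<omega> = n" for s \<omega>
  proof (rule yields_Seq_init[where t = 1 and u = "9 * n + 2"])
    show "yields (Assign ''i'' (N 0)) s 1 (return_pmf \<omega>) (\<lambda>_. round_inv I \<omega> 0)"
    proof (rule yields_straight)
      show "round_inv I \<omega> 0 (exec (Assign ''i'' (N 0)) s)"
        using inv len unfolding round_inv_def vote_inv_def stored_def m_def n_def tally_def
        by (simp add: spin_def)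
    qed simp_all
    fix s1 assume "round_inv I \<omega> 0 s1"
    then have "yields (While (Less (V ''i'') (V ''n'')) round_body) s1 (9 * n + 2) (return_pmf \<omega>) (\<lambda>_. round_inv I \<omega> n)"
    proof (rule yields_While_det[where t = 6])
      fix i s2 assume *: "i < n" "round_inv I \<omega> i s2"
      then show "bval (Less (V ''i'') (V ''n'')) s2 \<and> yields round_body s2 6 (return_pmf \<omega>) (\<lambda>_. round_inv I \<omega> (Suc i))"
        using round_body_correct[OF *(2)] by (simp add: n_def round_inv_def)
    qed (simp_all add: round_inv_def n_def)
    then show "yields (While (Less (V ''i'') (V ''n'')) round_body) s1 (9 * n + 2) (return_pmf \<omega>)
      (\<lambda>\<omega> s. \<forall>i<nvars I. snd s (int i) = rounded I \<omega> i)"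
      by (rule yields_mono) (simp_all add: n_def round_inv_def)
  qed simp
  have loop2: "yields (Assign ''p'' (N 2) ;; While (Less (V ''l'') (V ''m'')) vote_body ;; Assign ''i'' (N 0) ;;
        While (Less (V ''i'') (V ''n'')) round_body) s (9 * n + m * (15 * k + 26) + 9)
      (return_pmf \<omega>) (\<lambda>\<omega> s. \<forall>i<nvars I. snd s (int i) = rounded I \<omega> i)"
    if inv: "sample_inv ?xs n m n \<omega> s" for s \<omega>
  proof (rule yields_Seq_init[where t = 1 and u = "9 * n + m * (15 * k + 26) + 7"])
    have len: "length \<omega> = n" using inv by (simp add: sample_inv_def)
    show "yields (Assign ''p'' (N 2)) s 1 (return_pmf \<omega>) (\<lambda>_. vote_inv I \<omega> 0)"
    proof (rule yields_straight)
      show "vote_inv I \<omega> 0 (exec (Assign ''p'' (N 2)) s)"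
        using inv unfolding sample_inv_def vote_inv_def m_def n_def by (simp add: offset_def)
    qed simp_all
    fix s1 assume s1: "vote_inv I \<omega> 0 s1"
    show "yields (While (Less (V ''l'') (V ''m'')) vote_body ;; Assign ''i'' (N 0) ;;
        While (Less (V ''i'') (V ''n'')) round_body) s1 (9 * n + m * (15 * k + 26) + 7)
      (return_pmf \<omega>) (\<lambda>\<omega> s. \<forall>i<nvars I. snd s (int i) = rounded I \<omega> i)"
    proof (rule yields_Seq_init[where t = "m * (15 * k + 26) + 2" and u = "9 * n + 4"])
      show "yields (While (Less (V ''l'') (V ''m'')) vote_body) s1 (m * (15 * k + 26) + 2)
        (return_pmf \<omega>) (\<lambda>_. vote_inv I \<omega> m)"
        using s1
      proof (rule yields_While_det[where t = "15 * k + 23"])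
        fix l s2 assume "l < m" "vote_inv I \<omega> l s2"
        then show "bval (Less (V ''l'') (V ''m'')) s2 \<and>
            yields vote_body s2 (15 * k + 23) (return_pmf \<omega>) (\<lambda>_. vote_inv I \<omega> (Suc l))"
          using vote_body_correct[of I l \<omega> k s2 \<omega>] assms len
          by (simp add: m_def n_def vote_inv_def)
      qed (simp_all add: vote_inv_def m_def)
      show "yields (Assign ''i'' (N 0) ;; While (Less (V ''i'') (V ''n'')) round_body) s3 (9 * n + 4)
        (return_pmf \<omega>) (\<lambda>\<omega> s. \<forall>i<nvars I. snd s (int i) = rounded I \<omega> i)"
        if "vote_inv I \<omega> m s3" for s3 using loop3[OF that len] .
    qed simp
  qed simp
  have sampling: "yields (While (Less (V ''i'') (V ''n'')) sample_body) s (16 * n + 2)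
      (replicate_pmf n toss) (sample_inv ?xs n m n)" if "sample_inv ?xs n m 0 [] s" for s
  proof -
    have "yields (While (Less (V ''i'') (V ''n'')) sample_body) s (16 * n + 2)
      (iterate n (\<lambda>xs. map_pmf (\<lambda>x. xs @ [x]) toss) []) (sample_inv ?xs n m n)"
      using that
    proof (rule yields_While[where t = 13])
      fix i \<omega> s2 assume *: "i < n" "sample_inv ?xs n m i \<omega> s2"
      then show "bval (Less (V ''i'') (V ''n'')) s2 \<and>
          yields sample_body s2 13 (map_pmf (\<lambda>x. \<omega> @ [x]) toss) (sample_inv ?xs n m (Suc i))"
        using sample_body_correct[OF *(2)] by (simp add: sample_inv_def)
    qed (simp_all add: sample_inv_def)
    then show ?thesis by (simp add: iterate_append)
  qed
  have "yields rounding (init_state ?xs) (25 * n + m * (15 * k + 26) + 16)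
    (replicate_pmf n toss) (\<lambda>\<omega> s. \<forall>i<nvars I. snd s (int i) = rounded I \<omega> i)"
    unfolding rounding_def
  proof (rule yields_Seq_init[where t = 3 and u = "25 * n + m * (15 * k + 26) + 12"])
    show "yields (Assign ''n'' (Load (N 0)) ;; Assign ''m'' (Load (N 1))) (init_state ?xs) 3
      (return_pmf ()) (\<lambda>_. sample_inv ?xs n m 0 [])"
      using init_state_inv[of I] by (intro yields_straight) (simp_all add: n_def m_def)
    show "yields (While (Less (V ''i'') (V ''n'')) sample_body ;; Assign ''p'' (N 2) ;;
        While (Less (V ''l'') (V ''m'')) vote_body ;; Assign ''i'' (N 0) ;;
        While (Less (V ''i'') (V ''n'')) round_body) s (25 * n + m * (15 * k + 26) + 12)
      (replicate_pmf n toss) (\<lambda>\<omega> s. \<forall>i<nvars I. snd s (int i) = rounded I \<omega> i)"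
      if "sample_inv ?xs n m 0 [] s" for s
      using sampling[OF that] loop2
      by (rule yields_Seq_det) simp_all
  qed simp
  then show ?thesis by (simp add: n_def m_def)
qed

section \<open>Symmetries of the coin tosses\<close>

text \<open>For fixed sets this is an involution, and it keeps the greedy coins, so that activity of
  a constraint is preserved. The symmetry arguments apply it with suitable \<open>A\<close> and
  \<open>B\<close>; at a variable in both sets the negation wins.\<close>

definition twist :: "nat set \<Rightarrow> nat set \<Rightarrow> coins \<Rightarrow> coins" where
  "twist A B \<omega> = map (\<lambda>i. case \<omega> ! i of (g, y, y') \<Rightarrow>
     if i \<in> B then (g, \<not> y, y') else if i \<in> A then (g, y', y) else (g, y, y')) [0..<length \<omega>]"

lemma length_twist [simp]: "length (twist A B \<omega>) = length \<omega>"
  by (simp add: twist_def)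

lemma twist_twist [simp]: "twist A B (twist A B \<omega>) = \<omega>"
  by (rule nth_equalityI) (auto simp: twist_def split: prod.splits)

lemma greedy_twist [simp]: "i < length \<omega> \<Longrightarrow> greedy (twist A B \<omega>) i = greedy \<omega> i"
  by (simp add: greedy_def twist_def split: prod.splits)

lemma spin_twist [simp]:
  "i < length \<omega> \<Longrightarrow> spin (twist A B \<omega>) i =
     (if i \<in> B then - spin \<omega> i else if i \<in> A then spin' \<omega> i else spin \<omega> i)"
  by (simp add: spin_def spin'_def twist_def split: prod.splits)

lemma spin'_twist [simp]:
  "i < length \<omega> \<Longrightarrow> spin' (twist A B \<omega>) i = (if i \<in> A - B then spin \<omega> i else spin' \<omega> i)"
  by (simp add: spin_def spin'_def twist_def split: prod.splits)

definition tosses :: "nat \<Rightarrow> coins set" where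
  "tosses n = {\<omega>. length \<omega> = n}"

lemma tosses_conv_lists: "tosses n = {\<omega>. set \<omega> \<subseteq> UNIV \<and> length \<omega> = n}"
  by (simp add: tosses_def)

lemma finite_tosses [simp]: "finite (tosses n)"
  unfolding tosses_conv_lists by (rule finite_lists_length_eq) simp

lemma card_coins: "card (UNIV :: (bool \<times> bool \<times> bool) set) = 8"
  by (simp add: card_cartesian_product flip: UNIV_Times_UNIV)

lemma card_tosses: "card (tosses n) = 8 ^ n"
  unfolding tosses_conv_lists by (subst card_lists_length_eq) (simp_all add: card_coins)

text \<open>\<open>A\<close> may depend on the coins as long as the twist leaves it in place; the
  map is then its own inverse. In the applications \<open>A\<close> depends on the greedy coins
  only.\<close>

lemma bij_twist:
  assumes "\<And>\<omega>. \<omega> \<in> tosses n \<Longrightarrow> A (twist (A \<omega>) B \<omega>) = A \<omega>"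
  shows "bij_betw (\<lambda>\<omega>. twist (A \<omega>) B \<omega>) (tosses n) (tosses n)"
  by (rule bij_betw_byWitness[where f' = "\<lambda>\<omega>. twist (A \<omega>) B \<omega>"])
    (use assms in \<open>auto simp: tosses_def\<close>)

lemma sum_twist:
  assumes "\<And>\<omega>. \<omega> \<in> tosses n \<Longrightarrow> A (twist (A \<omega>) B \<omega>) = A \<omega>"
  shows "(\<Sum>\<omega>\<in>tosses n. f (twist (A \<omega>) B \<omega>)) = (\<Sum>\<omega>\<in>tosses n. f \<omega>)"
  by (rule sum.reindex_bij_betw[OF bij_twist[where A = A and B = B and n = n, OF assms]])

lemma toss_conv_pmf_of_set: "toss = pmf_of_set UNIV"
proof (rule pmf_eqI)
  fix x :: "bool \<times> bool \<times> bool"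
  obtain a b c where x: "x = (a, b, c)" by (cases x)
  have *: "toss = pair_pmf (bernoulli_pmf (1 / 2)) (pair_pmf (bernoulli_pmf (1 / 2)) (bernoulli_pmf (1 / 2)))"
    unfolding toss_def pair_pmf_def bind_assoc_pmf bind_return_pmf ..
  have "pmf toss x = 1 / 8"
    unfolding * by (simp add: x pmf_pair)
  then show "pmf toss x = pmf (pmf_of_set UNIV) x" by (simp add: card_coins)
qed

lemma replicate_pmf_conv_tosses: "replicate_pmf n toss = pmf_of_set (tosses n)"
proof (induction n)
  case 0
  have "tosses 0 = {[]}" by (auto simp: tosses_def)
  then show ?case by (simp add: pmf_of_set_singleton)
next
  case (Suc n)
  have "replicate_pmf (Suc n) toss = map_pmf (\<lambda>(x, xs). x # xs) (pair_pmf toss (replicate_pmf n toss))"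
    by (simp add: pair_pmf_def map_bind_pmf)
  also have "pair_pmf toss (replicate_pmf n toss) = pmf_of_set (UNIV \<times> tosses n)"
  proof (rule pmf_eqI)
    fix x
    have "tosses n \<noteq> {}" using card_tosses[of n] by force
    then show "pmf (pair_pmf toss (replicate_pmf n toss)) x = pmf (pmf_of_set (UNIV \<times> tosses n)) x"
      unfolding Suc unfolding toss_conv_pmf_of_set
      by (cases x) (simp add: pmf_pair card_cartesian_product indicator_def)
  qed
  also have "map_pmf (\<lambda>(x, xs). x # xs) \<dots> = pmf_of_set ((\<lambda>(x, xs). x # xs) ` (UNIV \<times> tosses n))"
    by (rule map_pmf_of_set_inj) (use card_tosses[of n] in \<open>force simp: inj_on_def\<close>)+
  also have "(\<lambda>(x, xs). x # xs) ` (UNIV \<times> tosses n) = tosses (Suc n)"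
    by (auto simp: tosses_def length_Suc_conv image_iff)
  finally show ?case .
qed

section \<open>Gains and uniformly distributed signs\<close>

lemma gain_cong:
  assumes "\<And>i. i \<in> set (scope c) \<Longrightarrow> i \<noteq> j \<Longrightarrow> x i = x' i"
  shows "gain c j x = gain c j x'"
proof -
  have "map (x(j := a)) (scope c) = map (x'(j := a)) (scope c)" for a
    using assms by simp
  then show ?thesis by (simp only: gain_def)
qed

lemma gain_abs_le: "\<bar>gain c j x\<bar> \<le> 1"
  by (simp add: gain_def)

text \<open>A function of a single sign is affine, with slope half the difference of its two
  values.\<close>

lemma pred_diff_conv_gain:
  assumes "x j \<in> {-1, 1}" "x' j \<in> {-1, 1}"
    and "\<And>i. i \<in> set (scope c) \<Longrightarrow> i \<noteq> j \<Longrightarrow> x i = x' i"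
  shows "of_bool (pred c (map x (scope c))) - of_bool (pred c (map x' (scope c))) =
    (real_of_int (x j) - real_of_int (x' j)) / 2 * real_of_int (gain c j x)"
proof -
  have x': "map x' (scope c) = map (x(j := x' j)) (scope c)" using assms(3) by simp
  have x: "map x (scope c) = map (x(j := x j)) (scope c)" by simp
  show ?thesis
    unfolding x' gain_def
    by (subst x) (use assms(1,2) in \<open>elim insertE emptyE; simp del: fun_upd_apply map_eq_conv fun_upd_triv\<close>)
qed

lemma cube_update: "z \<in> cube r \<Longrightarrow> t < r \<Longrightarrow> z[t := - z ! t] \<in> cube r"
proof -
  assume z: "z \<in> cube r" "t < r"
  then have "z ! t \<in> {-1, 1}" using nth_mem[of t z] unfolding cube_def by blast
  then have "insert (- z ! t) (set z) \<subseteq> {-1, 1}" using z(1) by (auto simp: cube_def)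
  with set_update_subset_insert[of z t "- z ! t"] z(1) show ?thesis unfolding cube_def by auto
qed

lemma card_cube: "card (cube r) = 2 ^ r" and finite_cube: "finite (cube r)"
  using card_lists_length_eq[of "{-1, 1 :: int}" r] finite_lists_length_eq[of "{-1, 1 :: int}" r]
  by (simp_all add: cube_def conj_commute numeral_2_eq_2)

text \<open>Any point of the cube reaches the all-ones point by turning its entries -1 into 1 one at
  a time; the number of such entries decreases.\<close>

lemma cube_flip_induct:
  assumes "z \<in> cube r"
    and "\<And>z t. z \<in> cube r \<Longrightarrow> t < r \<Longrightarrow> z ! t = -1 \<Longrightarrow> P (z[t := 1]) \<Longrightarrow> P z"
    and "P (replicate r 1)"
  shows "P z"
  using assms(1)
proof (induction "card {t. t < r \<and> z ! t = -1}" arbitrary: z rule: less_induct)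
  case less
  show ?case
  proof (cases "\<exists>t<r. z ! t = -1")
    case True
    then obtain t where t: "t < r" "z ! t = -1" by blast
    have len: "length z = r" using less.prems by (simp add: cube_def)
    have "z[t := - z ! t] \<in> cube r" using less.prems t(1) by (rule cube_update)
    then have cube: "z[t := 1] \<in> cube r" using t by simp
    have "{u. u < r \<and> z[t := 1] ! u = -1} \<subset> {u. u < r \<and> z ! u = -1}"
      using t len by (auto simp: nth_list_update)
    then have "card {u. u < r \<and> z[t := 1] ! u = -1} < card {u. u < r \<and> z ! u = -1}"
      by (intro psubset_card_mono) auto
    from less.hyps[OF this cube] show ?thesis using assms(2)[OF less.prems t] by blast
  next
    case False
    have len: "length z = r" and "set z \<subseteq> {-1, 1}" using less.prems by (simp_all add: cube_def)
    then have "z ! t = 1" if "t < r" for t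
      using False that nth_mem[of t z] by blast
    with len have "z = replicate r 1" by (intro nth_equalityI) simp_all
    then show ?thesis using assms(3) by simp
  qed
qed

text \<open>All fibres of \<open>\<omega> \<mapsto> map (u \<omega>) sc\<close> have the same size, since flips of single coordinates act transitively on the cube.\<close>

lemma sum_over_uniform_signs:
  fixes f :: "int list \<Rightarrow> real"
  assumes fin: "finite \<Omega>" and sc: "distinct sc"
    and u: "\<And>\<omega> i. \<omega> \<in> \<Omega> \<Longrightarrow> i \<in> set sc \<Longrightarrow> u \<omega> i \<in> {-1, 1 :: int}"
    and flip: "\<And>i. i \<in> set sc \<Longrightarrow> \<exists>\<phi>. bij_betw \<phi> \<Omega> \<Omega> \<and>
       (\<forall>\<omega>\<in>\<Omega>. \<forall>k\<in>set sc. u (\<phi> \<omega>) k = (if k = i then - u \<omega> k else u \<omega> k))"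
  shows "(\<Sum>\<omega>\<in>\<Omega>. f (map (u \<omega>) sc)) = real (card \<Omega>) * ((\<Sum>z\<in>cube (length sc). f z) / 2 ^ length sc)"
proof -
  define r where "r = length sc"
  define F where "F z = {\<omega> \<in> \<Omega>. map (u \<omega>) sc = z}" for z
  have mem: "map (u \<omega>) sc \<in> cube r" if "\<omega> \<in> \<Omega>" for \<omega>
  proof -
    have "set (map (u \<omega>) sc) \<subseteq> {-1, 1}" using u[OF that] unfolding set_map by blast
    then show ?thesis unfolding cube_def r_def by simp
  qed
  have step: "card (F z) = card (F (z[t := - z ! t]))" if "z \<in> cube r" "t < r" for z t
  proof -
    have t: "sc ! t \<in> set sc" using that(2) by (simp add: r_def)
    from flip[OF t] obtain \<phi> where \<phi>: "bij_betw \<phi> \<Omega> \<Omega>"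
      "\<And>\<omega> k. \<omega> \<in> \<Omega> \<Longrightarrow> k \<in> set sc \<Longrightarrow> u (\<phi> \<omega>) k = (if k = sc ! t then - u \<omega> k else u \<omega> k)"
      by (elim exE conjE) simp
    have map_\<phi>: "map (u (\<phi> \<omega>)) sc = (map (u \<omega>) sc)[t := - map (u \<omega>) sc ! t]" if "\<omega> \<in> \<Omega>" for \<omega>
    proof (intro nth_equalityI)
      fix k assume "k < length (map (u (\<phi> \<omega>)) sc)"
      then have k: "k < length sc" by simp
      then have "sc ! k = sc ! t \<longleftrightarrow> k = t" using sc \<open>t < r\<close> by (simp add: nth_eq_iff_index_eq r_def)
      then show "map (u (\<phi> \<omega>)) sc ! k = (map (u \<omega>) sc)[t := - map (u \<omega>) sc ! t] ! k"
        using \<phi>(2)[OF that nth_mem[OF k]] k by (simp add: nth_list_update)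
    qed simp
    have "bij_betw \<phi> (F z) (F (z[t := - z ! t]))"
      unfolding bij_betw_def
    proof
      show "inj_on \<phi> (F z)"
        by (rule inj_on_subset[of \<phi> \<Omega>]) (use \<phi>(1) in \<open>simp_all add: bij_betw_def F_def\<close>)
      have len: "length z = r" using that by (simp add: cube_def)
      show "\<phi> ` F z = F (z[t := - z ! t])"
      proof (intro equalityI subsetI)
        fix \<omega> assume "\<omega> \<in> \<phi> ` F z"
        then obtain \<omega>' where "\<omega>' \<in> \<Omega>" "map (u \<omega>') sc = z" "\<omega> = \<phi> \<omega>'" unfolding F_def by blast
        then show "\<omega> \<in> F (z[t := - z ! t])"
          using map_\<phi>[of \<omega>'] bij_betw_apply[OF \<phi>(1), of \<omega>'] by (simp add: F_def)
      next
        fix \<omega> assume "\<omega> \<in> F (z[t := - z ! t])"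
        then have \<omega>: "\<omega> \<in> \<Omega>" "map (u \<omega>) sc = z[t := - z ! t]" by (auto simp: F_def)
        then obtain \<omega>' where \<omega>': "\<omega>' \<in> \<Omega>" "\<omega> = \<phi> \<omega>'" using \<phi>(1) unfolding bij_betw_def by blast
        define w where "w = map (u \<omega>') sc"
        have undo: "l = (l[t := - l ! t])[t := - l[t := - l ! t] ! t]" if "length l = r" for l :: "int list"
          using that \<open>t < r\<close> by simp
        have "length w = r" by (simp add: w_def r_def)
        have "w[t := - w ! t] = z[t := - z ! t]"
          using map_\<phi>[OF \<omega>'(1)] \<omega>(2) \<omega>'(2) by (simp add: w_def)
        \<comment> \<open>Flipping coordinate \<open>t\<close> is an involution, so equal flips come
          from equal lists.\<close>
        then have "w = z" by (subst undo[OF \<open>length w = r\<close>], subst undo[OF len]) (rule arg_cong)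
        then show "\<omega> \<in> \<phi> ` F z" using \<omega>' unfolding F_def w_def by blast
      qed
    qed
    then show ?thesis by (rule bij_betw_same_card)
  qed
  define M where "M = card (F (replicate r 1))"
  have const: "card (F z) = M" if "z \<in> cube r" for z
    using that
  proof (rule cube_flip_induct)
    fix z t assume "z \<in> cube r" "t < r" "z ! t = -1" "card (F (z[t := 1])) = M"
    then show "card (F z) = M" using step[of z t] by simp
  qed (simp add: M_def)
  have fibres: "(\<Sum>\<omega>\<in>\<Omega>. g (map (u \<omega>) sc)) = real M * (\<Sum>z\<in>cube r. g z)" for g :: "int list \<Rightarrow> real"
  proof -
    have "(\<Sum>\<omega>\<in>\<Omega>. g (map (u \<omega>) sc)) = (\<Sum>z\<in>cube r. \<Sum>\<omega>\<in>F z. g (map (u \<omega>) sc))"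
      unfolding F_def by (rule sum.group[symmetric]) (use fin finite_cube mem in \<open>simp_all add: image_subset_iff\<close>)
    also have "\<dots> = (\<Sum>z\<in>cube r. \<Sum>\<omega>\<in>F z. g z)"
      by (intro sum.cong) (simp_all add: F_def)
    also have "\<dots> = real M * (\<Sum>z\<in>cube r. g z)"
      by (simp add: const sum_distrib_left)
    finally show ?thesis .
  qed
  \<comment> \<open>The constant function 1 determines the common fibre size
    \<open>M\<close>.\<close>
  from fibres[of "\<lambda>_. 1"] have "real (card \<Omega>) = real M * 2 ^ r" by (simp add: card_cube)
  with fibres[of f] show ?thesis by (simp add: r_def)
qed

lemma mean_conv_sum: "mean c = (\<Sum>z\<in>cube (arity c). of_bool (pred c z)) / 2 ^ arity c"
proof -
  have "cube (arity c) \<noteq> {}" using card_cube[of "arity c"] by force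
  then show ?thesis by (simp add: mean_def integral_pmf_of_set finite_cube card_cube)
qed

section \<open>Consequences of triangle-freeness\<close>

locale triangle_free_csp =
  fixes I :: csp
  assumes valid: "valid_csp I" and tri_free: "triangle_free I"
    and arity_ge_2: "\<And>c. c \<in> set (constraints I) \<Longrightarrow> 2 \<le> arity c"
begin

abbreviation cn :: "nat \<Rightarrow> cons" where "cn l \<equiv> constraints I ! l"
abbreviation S :: "nat \<Rightarrow> nat set" where "S l \<equiv> scope_at I l"
abbreviation \<Omega> :: "coins set" where "\<Omega> \<equiv> tosses (nvars I)"

lemma scope_subset: "l < ncons I \<Longrightarrow> i \<in> S l \<Longrightarrow> i < nvars I"
  using valid nth_mem unfolding valid_csp_def by blast

lemma distinct_scope: "l < ncons I \<Longrightarrow> distinct (scope (cn l))"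
  using valid nth_mem unfolding valid_csp_def by blast

lemma two_common:
  assumes "a < ncons I" "b < ncons I" "i \<in> S a" "i \<in> S b" "k \<in> S a" "k \<in> S b" "i \<noteq> k"
  shows "a = b"
proof (rule ccontr)
  assume "a \<noteq> b"
  then have "card (S a \<inter> S b) \<le> 1" using tri_free assms(1,2) unfolding triangle_free_def by blast
  moreover have "card {i, k} \<le> card (S a \<inter> S b)"
    using assms by (intro card_mono) auto
  ultimately show False using assms(7) by simp
qed

text \<open>\<open>i\<close>, \<open>k\<close> and \<open>v\<close> witness the three intersections.
  If \<open>b\<close> and \<open>c\<close> differed, the three scopes would need a common variable
  \<open>w\<close> in order not to form a triangle. As \<open>w\<close> lies in \<open>S a\<close>
  and \<open>v\<close> does not, \<open>b\<close> and \<open>c\<close> would share two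
  variables.\<close>

lemma no_triangle:
  assumes "a < ncons I" "b < ncons I" "c < ncons I"
    and "i \<in> S a" "i \<in> S b" "k \<in> S a" "k \<in> S c" "v \<in> S b" "v \<in> S c" "i \<noteq> k" "v \<notin> S a"
    and "a \<noteq> b" "a \<noteq> c"
  shows "b = c"
proof (rule ccontr)
  assume "b \<noteq> c"
  have "S a \<inter> S b \<inter> S c \<noteq> {}"
    using tri_free assms \<open>b \<noteq> c\<close> unfolding triangle_free_def by blast
  then obtain w where w: "w \<in> S a" "w \<in> S b" "w \<in> S c" by blast
  then have "w \<noteq> v" using assms(11) by blast
  with two_common[of b c w v] w assms \<open>b \<noteq> c\<close> show False by blast
qed

lemma active_twist [simp]:
  assumes "l < ncons I" "\<omega> \<in> \<Omega>"
  shows "active (cn l) j (twist A B \<omega>) \<longleftrightarrow> active (cn l) j \<omega>"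
proof -
  have "greedy (twist A B \<omega>) i \<longleftrightarrow> greedy \<omega> i" if "i \<in> S l" for i
    using scope_subset[OF assms(1) that] assms(2) by (simp add: tosses_def)
  then have "{i \<in> S l. greedy (twist A B \<omega>) i} = {i \<in> S l. greedy \<omega> i}" by blast
  then show ?thesis by (simp only: active_def)
qed

lemma activeD:
  assumes "active c j \<omega>"
  shows "j \<in> set (scope c)" "greedy \<omega> j" "\<And>i. i \<in> set (scope c) \<Longrightarrow> greedy \<omega> i \<Longrightarrow> i = j"
  using assms unfolding active_def by blast+

lemma spin_cases: "spin \<omega> i \<in> {-1, 1}" "spin' \<omega> i \<in> {-1, 1}"
  by (simp_all add: spin_def spin'_def)

lemma rounded_cases: "rounded I \<omega> i \<in> {-1, 1}"
  using spin_cases by (simp add: rounded_def)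

text \<open>Each gain reads the variables of the scope other than \<open>j\<close>. All of them are
  exchanged and none is negated, so the two gains trade places, while activity is unchanged.\<close>

lemma vote_twist_neg:
  assumes "l < ncons I" "\<omega> \<in> \<Omega>" "S l - {j} \<subseteq> A" "(S l - {j}) \<inter> B = {}"
  shows "gain (cn l) j (spin (twist A B \<omega>)) = gain (cn l) j (spin' \<omega>)"
    and "gain (cn l) j (spin' (twist A B \<omega>)) = gain (cn l) j (spin \<omega>)"
    and "vote (cn l) j (twist A B \<omega>) = - vote (cn l) j \<omega>"
proof -
  have len: "i < length \<omega>" if "i \<in> S l" for i
    using scope_subset[OF assms(1) that] assms(2) by (simp add: tosses_def)
  show *: "gain (cn l) j (spin (twist A B \<omega>)) = gain (cn l) j (spin' \<omega>)"
    "gain (cn l) j (spin' (twist A B \<omega>)) = gain (cn l) j (spin \<omega>)"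
    by (rule gain_cong; use len assms(3,4) in auto)+
  show "vote (cn l) j (twist A B \<omega>) = - vote (cn l) j \<omega>"
    using assms(1,2) by (simp add: vote_def *)
qed

lemma gain_twist_id:
  assumes "l < ncons I" "\<omega> \<in> \<Omega>" "(S l - {j}) \<inter> (A \<union> B) = {}"
  shows "gain (cn l) j (spin (twist A B \<omega>)) = gain (cn l) j (spin \<omega>)"
    and "gain (cn l) j (spin' (twist A B \<omega>)) = gain (cn l) j (spin' \<omega>)"
proof -
  have len: "i < length \<omega>" if "i \<in> S l" for i
    using scope_subset[OF assms(1) that] assms(2) by (simp add: tosses_def)
  show "gain (cn l) j (spin (twist A B \<omega>)) = gain (cn l) j (spin \<omega>)"
    "gain (cn l) j (spin' (twist A B \<omega>)) = gain (cn l) j (spin' \<omega>)"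
    by (rule gain_cong; use len assms(3) in auto)+
qed

lemma vote_twist_id:
  assumes "l < ncons I" "\<omega> \<in> \<Omega>" "active (cn l) j \<omega> \<Longrightarrow> (S l - {j}) \<inter> (A \<union> B) = {}"
  shows "vote (cn l) j (twist A B \<omega>) = vote (cn l) j \<omega>"
  using assms gain_twist_id[OF assms(1,2)] by (simp add: vote_def)

text \<open>The fixed variables that the tally of \<open>j\<close> reads.\<close>

definition nbhd :: "nat \<Rightarrow> coins \<Rightarrow> nat set" where
  "nbhd j \<omega> = {v. v \<noteq> j \<and> (\<exists>l<ncons I. active (cn l) j \<omega> \<and> v \<in> S l)}"

lemma nbhd_twist [simp]: "\<omega> \<in> \<Omega> \<Longrightarrow> nbhd j (twist A B \<omega>) = nbhd j \<omega>"
  unfolding nbhd_def by auto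

lemma vote_inactive: "\<not> active c j \<omega> \<Longrightarrow> vote c j \<omega> = 0"
  by (simp add: vote_def)

text \<open>For every constraint active for \<open>j\<close>, the scope without \<open>j\<close>
  lies in \<open>nbhd j \<omega>\<close>, so all votes change sign at once.\<close>

lemma tally_twist_nbhd:
  assumes "\<omega> \<in> \<Omega>"
  shows "tally I j (twist (nbhd j \<omega>) {j} \<omega>) = - tally I j \<omega>"
proof -
  have "vote (cn l) j (twist (nbhd j \<omega>) {j} \<omega>) = - vote (cn l) j \<omega>" if "l < ncons I" for l
  proof (cases "active (cn l) j \<omega>")
    case True
    then show ?thesis using that assms by (intro vote_twist_neg) (auto simp: nbhd_def)
  next
    case False
    then show ?thesis using that assms by (simp add: vote_inactive)
  qed
  then show ?thesis by (simp add: tally_def sum_negf)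
qed

text \<open>A nonzero tally changes sign, and in a tie the negated sign of \<open>j\<close>
  decides.\<close>

lemma rounded_twist_nbhd:
  assumes "\<omega> \<in> \<Omega>" "j < nvars I"
  shows "rounded I (twist (nbhd j \<omega>) {j} \<omega>) j = - rounded I \<omega> j"
  using assms tally_twist_nbhd[OF assms(1), of j] by (simp add: rounded_def tosses_def)

lemma rounded_not_greedy:
  assumes "\<not> greedy \<omega> i"
  shows "rounded I \<omega> i = spin \<omega> i"
proof -
  have "\<not> active c i \<omega>" for c using activeD(2) assms by blast
  then have "tally I i \<omega> = 0" by (simp add: tally_def vote_inactive)
  then show ?thesis by (simp add: rounded_def)
qed

text \<open>A constraint \<open>b\<close> active for \<open>k\<close> differs from the inactive
  \<open>l\<close>, so it cannot also contain \<open>i\<close>. If it met a constraint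
  \<open>c\<close> active for \<open>i\<close> in a further variable \<open>v\<close>, then
  \<open>l\<close>, \<open>b\<close> and \<open>c\<close> would form a triangle through
  \<open>i\<close>, \<open>k\<close> and \<open>v\<close>. Hence the tally of \<open>k\<close> reads
  nothing that the twist moves.\<close>

lemma rounded_twist_other:
  assumes l: "l < ncons I" "\<omega> \<in> \<Omega>" "i \<in> S l" "k \<in> S l" "k \<noteq> i"
    and inactive: "\<And>j. \<not> active (cn l) j \<omega>"
  shows "rounded I (twist (nbhd i \<omega>) {i} \<omega>) k = rounded I \<omega> k"
proof -
  have disj: "(S b - {k}) \<inter> (nbhd i \<omega> \<union> {i}) = {}" if b: "b < ncons I" "active (cn b) k \<omega>" for b
  proof -
    have bl: "l \<noteq> b" using inactive b(2) by blast
    have kb: "k \<in> S b" using activeD(1)[OF b(2)] .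
    have i: "i \<notin> S b" using two_common[of l b i k] l b(1) bl kb by blast
    have "v \<notin> nbhd i \<omega>" if v: "v \<in> S b" "v \<noteq> k" for v
    proof
      assume "v \<in> nbhd i \<omega>"
      then obtain c where c: "c < ncons I" "active (cn c) i \<omega>" "v \<in> S c" "v \<noteq> i"
        unfolding nbhd_def by blast
      have cl: "l \<noteq> c" using inactive c(2) by blast
      have "v \<notin> S l" using two_common[of l b k v] l b(1) v bl kb by blast
      then have "b = c"
        using no_triangle[of l b c k i v] l b(1) c kb v bl cl activeD(1)[OF c(2)] by blast
      then show False using activeD(1)[OF c(2)] i by blast
    qed
    then show ?thesis using i by blast
  qed
  \<comment> \<open>The own sign of \<open>k\<close>, which decides a tie, is not exchanged
    either.\<close>
  have "k \<notin> nbhd i \<omega>"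
  proof
    assume "k \<in> nbhd i \<omega>"
    then obtain c where c: "c < ncons I" "active (cn c) i \<omega>" "k \<in> S c" unfolding nbhd_def by blast
    then have "l = c" using two_common[of l c i k] l activeD(1)[OF c(2)] by blast
    then show False using inactive c(2) by blast
  qed
  moreover have "tally I k (twist (nbhd i \<omega>) {i} \<omega>) = tally I k \<omega>"
    unfolding tally_def using disj l(2) by (intro sum.cong refl vote_twist_id) auto
  ultimately show ?thesis
    using l scope_subset[OF l(1) l(4)] by (simp add: rounded_def tosses_def)
qed

section \<open>Comparing the rounded assignment with uniform signs\<close>

definition unround :: "nat \<Rightarrow> coins \<Rightarrow> nat \<Rightarrow> int" where
  "unround l \<omega> = (if \<exists>j. active (cn l) j \<omega> then spin \<omega> else rounded I \<omega>)"

text \<open>\<open>unround\<close> undoes the rounding for a constraint that is active for some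
  variable; then plain negation flips the sign of \<open>i\<close>. In an inactive constraint the
  twist with \<open>nbhd i\<close> flips it and leaves the rest of the scope alone. So each
  coordinate of the scope is flipped by a bijection of the coins, and the predicate sees uniform
  inputs.\<close>

lemma sum_pred_unround:
  assumes l: "l < ncons I"
  shows "(\<Sum>\<omega>\<in>\<Omega>. of_bool (pred (cn l) (map (unround l \<omega>) (scope (cn l))))) =
    8 ^ nvars I * mean (cn l)"
proof -
  have "(\<Sum>\<omega>\<in>\<Omega>. of_bool (pred (cn l) (map (unround l \<omega>) (scope (cn l)))) :: real) =
    real (card \<Omega>) * ((\<Sum>z\<in>cube (arity (cn l)). of_bool (pred (cn l) z)) / 2 ^ arity (cn l))"
  proof (rule sum_over_uniform_signs)
    fix i assume i: "i \<in> S l"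
    \<comment> \<open>This set depends on the greedy coins alone, so the twist preserves it and is a
      bijection.\<close>
    define A where "A \<omega> = (if \<exists>j. active (cn l) j \<omega> then {} else nbhd i \<omega>)" for \<omega>
    have A: "A (twist (A \<omega>) {i} \<omega>) = A \<omega>" if "\<omega> \<in> \<Omega>" for \<omega>
      using that l by (simp add: A_def)
    have "unround l (twist (A \<omega>) {i} \<omega>) k = (if k = i then - unround l \<omega> k else unround l \<omega> k)"
      if \<omega>: "\<omega> \<in> \<Omega>" and k: "k \<in> S l" for \<omega> k
    proof (cases "\<exists>j. active (cn l) j \<omega>")
      case True
      then show ?thesis using l \<omega> scope_subset[OF l k] by (simp add: unround_def A_def tosses_def[of "nvars I"])
    next
      case False
      then have "unround l (twist (A \<omega>) {i} \<omega>) k = rounded I (twist (nbhd i \<omega>) {i} \<omega>) k"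
        using l \<omega> by (simp add: unround_def A_def)
      then show ?thesis
        using rounded_twist_nbhd[OF \<omega> scope_subset[OF l i]] rounded_twist_other[OF l \<omega> i k] False
        by (simp add: unround_def)
    qed
    then show "\<exists>\<phi>. bij_betw \<phi> \<Omega> \<Omega> \<and>
       (\<forall>\<omega>\<in>\<Omega>. \<forall>k\<in>S l. unround l (\<phi> \<omega>) k = (if k = i then - unround l \<omega> k else unround l \<omega> k))"
      using bij_twist[where A = A and B = "{i}", OF A] by blast
  qed (use l distinct_scope spin_cases rounded_cases in \<open>auto simp: unround_def\<close>)
  then show ?thesis by (simp add: mean_conv_sum card_tosses)
qed

text \<open>A constraint is active for at most one \<open>j\<close>. Its other variables are not
  greedy and keep their signs, so only the value at \<open>j\<close> changes and
  \<open>pred_diff_conv_gain\<close> applies.\<close>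

lemma pred_rounded_conv_unround:
  assumes l: "l < ncons I"
  shows "of_bool (pred (cn l) (map (rounded I \<omega>) (scope (cn l)))) =
    of_bool (pred (cn l) (map (unround l \<omega>) (scope (cn l)))) +
    (\<Sum>j\<in>S l. of_bool (active (cn l) j \<omega>) *
       ((real_of_int (rounded I \<omega> j) - real_of_int (spin \<omega> j)) / 2 * real_of_int (gain (cn l) j (spin \<omega>))))"
proof (cases "\<exists>j. active (cn l) j \<omega>")
  case True
  then obtain j where j: "active (cn l) j \<omega>" ..
  have others: "rounded I \<omega> i = spin \<omega> i" if "i \<in> S l" "i \<noteq> j" for i
    using activeD(3)[OF j] that rounded_not_greedy by blast
  have gain: "gain (cn l) j (rounded I \<omega>) = gain (cn l) j (spin \<omega>)"
    using others by (rule gain_cong)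
  have "active (cn l) i \<omega> \<longleftrightarrow> i = j" for i
    using j unfolding active_def by auto
  then have delta: "of_bool (active (cn l) i \<omega>) * y = (if i = j then y else 0)" for i and y :: real by simp
  have "(\<Sum>i\<in>S l. of_bool (active (cn l) i \<omega>) *
       ((real_of_int (rounded I \<omega> i) - real_of_int (spin \<omega> i)) / 2 * real_of_int (gain (cn l) i (spin \<omega>)))) =
    (real_of_int (rounded I \<omega> j) - real_of_int (spin \<omega> j)) / 2 * real_of_int (gain (cn l) j (spin \<omega>))"
    unfolding delta using activeD(1)[OF j] by simp
  moreover have "of_bool (pred (cn l) (map (rounded I \<omega>) (scope (cn l)))) -
      of_bool (pred (cn l) (map (spin \<omega>) (scope (cn l)))) =
    (real_of_int (rounded I \<omega> j) - real_of_int (spin \<omega> j)) / 2 * real_of_int (gain (cn l) j (spin \<omega>))"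
    unfolding gain[symmetric] using others by (intro pred_diff_conv_gain rounded_cases spin_cases)
  moreover have "unround l \<omega> = spin \<omega>" using True by (simp add: unround_def)
  ultimately show ?thesis by (simp only:)
qed (simp add: unround_def)

text \<open>Negating the sign of \<open>j\<close> negates the product, because neither the gain nor
  activity reads that sign.\<close>

lemma sum_spin_gain:
  assumes "l < ncons I" "j \<in> S l"
  shows "(\<Sum>\<omega>\<in>\<Omega>. of_bool (active (cn l) j \<omega>) * (real_of_int (spin \<omega> j) * real_of_int (gain (cn l) j (spin \<omega>)))) = 0"
    (is "sum ?f \<Omega> = 0")
proof -
  have "sum ?f \<Omega> = (\<Sum>\<omega>\<in>\<Omega>. ?f (twist {} {j} \<omega>))"
    by (rule sum_twist[where A = "\<lambda>_. {}" and B = "{j}", symmetric]) simp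
  also have "\<dots> = (\<Sum>\<omega>\<in>\<Omega>. - ?f \<omega>)"
    using assms scope_subset[OF assms]
    by (intro sum.cong refl) (simp add: gain_twist_id, simp add: tosses_def)
  finally show ?thesis by (simp add: sum_negf)
qed

text \<open>The twist with \<open>nbhd j\<close> negates the output at \<open>j\<close> and turns
  \<open>W\<close>, the total gain under \<open>y\<close>, into \<open>W'\<close>, that under
  \<open>y'\<close>. So the sum of output times \<open>W\<close> is half the sum of output times
  \<open>W - W'\<close>. This difference is the tally, and the output times the tally is its
  absolute value.\<close>

lemma sum_rounded_gain:
  assumes j: "j < nvars I"
  shows "(\<Sum>\<omega>\<in>\<Omega>. real_of_int (rounded I \<omega> j) *
      (\<Sum>l<ncons I. of_bool (active (cn l) j \<omega>) * real_of_int (gain (cn l) j (spin \<omega>)))) =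
    (\<Sum>\<omega>\<in>\<Omega>. \<bar>real_of_int (tally I j \<omega>)\<bar>) / 2"
proof -
  define W where "W \<omega> = (\<Sum>l<ncons I. of_bool (active (cn l) j \<omega>) * real_of_int (gain (cn l) j (spin \<omega>)))" for \<omega>
  define W' where "W' \<omega> = (\<Sum>l<ncons I. of_bool (active (cn l) j \<omega>) * real_of_int (gain (cn l) j (spin' \<omega>)))" for \<omega>
  have "(\<Sum>\<omega>\<in>\<Omega>. real_of_int (rounded I \<omega> j) * W \<omega>) =
      (\<Sum>\<omega>\<in>\<Omega>. real_of_int (rounded I (twist (nbhd j \<omega>) {j} \<omega>) j) * W (twist (nbhd j \<omega>) {j} \<omega>))"
    by (rule sum_twist[where A = "nbhd j" and B = "{j}", symmetric]) simp
  also have "\<dots> = (\<Sum>\<omega>\<in>\<Omega>. - (real_of_int (rounded I \<omega> j) * W' \<omega>))"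
  proof (intro sum.cong refl)
    fix \<omega> assume \<omega>: "\<omega> \<in> \<Omega>"
    have "W (twist (nbhd j \<omega>) {j} \<omega>) = W' \<omega>"
      unfolding W_def W'_def
    proof (intro sum.cong refl)
      fix l assume "l \<in> {..<ncons I}"
      then show "of_bool (active (cn l) j (twist (nbhd j \<omega>) {j} \<omega>)) * real_of_int (gain (cn l) j (spin (twist (nbhd j \<omega>) {j} \<omega>))) =
        of_bool (active (cn l) j \<omega>) * real_of_int (gain (cn l) j (spin' \<omega>))"
        using \<omega> vote_twist_neg(1)[of l \<omega> j "nbhd j \<omega>" "{j}"]
        by (cases "active (cn l) j \<omega>") (auto simp: nbhd_def)
    qed
    then show "real_of_int (rounded I (twist (nbhd j \<omega>) {j} \<omega>) j) * W (twist (nbhd j \<omega>) {j} \<omega>) =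
        - (real_of_int (rounded I \<omega> j) * W' \<omega>)"
      using rounded_twist_nbhd[OF \<omega> j] by simp
  qed
  finally have sym: "(\<Sum>\<omega>\<in>\<Omega>. real_of_int (rounded I \<omega> j) * W \<omega>) = - (\<Sum>\<omega>\<in>\<Omega>. real_of_int (rounded I \<omega> j) * W' \<omega>)"
    by (simp add: sum_negf)
  have tally: "real_of_int (tally I j \<omega>) = W \<omega> - W' \<omega>" for \<omega>
    unfolding tally_def W_def W'_def sum_subtractf[symmetric] of_int_sum
    by (intro sum.cong refl) (simp add: vote_def)
  have "\<bar>real_of_int (tally I j \<omega>)\<bar> = real_of_int (rounded I \<omega> j) * W \<omega> - real_of_int (rounded I \<omega> j) * W' \<omega>" for \<omega>
  proof -
    have "\<bar>real_of_int (tally I j \<omega>)\<bar> = real_of_int (rounded I \<omega> j) * real_of_int (tally I j \<omega>)"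
      by (auto simp: rounded_def)
    then show ?thesis by (simp add: tally algebra_simps)
  qed
  then have "(\<Sum>\<omega>\<in>\<Omega>. \<bar>real_of_int (tally I j \<omega>)\<bar>) = 2 * (\<Sum>\<omega>\<in>\<Omega>. real_of_int (rounded I \<omega> j) * W \<omega>)"
    using sym by (simp add: sum_subtractf)
  then show ?thesis by (simp add: W_def)
qed

text \<open>The factor 1/4 is 1/2 from \<open>pred_diff_conv_gain\<close> times 1/2 from
  \<open>sum_rounded_gain\<close>; the part with \<open>spin\<close> averages to 0.\<close>

lemma sum_excess:
  "(\<Sum>\<omega>\<in>\<Omega>. \<Sum>l<ncons I. of_bool (pred (cn l) (map (rounded I \<omega>) (scope (cn l)))) - mean (cn l)) =
   (\<Sum>j<nvars I. \<Sum>\<omega>\<in>\<Omega>. \<bar>real_of_int (tally I j \<omega>)\<bar>) / 4"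
proof -
  define h where "h l j \<omega> = of_bool (active (cn l) j \<omega>) * (real_of_int (rounded I \<omega> j) * real_of_int (gain (cn l) j (spin \<omega>)))" for l j \<omega>
  have one: "(\<Sum>\<omega>\<in>\<Omega>. of_bool (pred (cn l) (map (rounded I \<omega>) (scope (cn l)))) - mean (cn l)) =
      (\<Sum>j<nvars I. \<Sum>\<omega>\<in>\<Omega>. h l j \<omega>) / 2" if l: "l < ncons I" for l
  proof -
    have "(\<Sum>\<omega>\<in>\<Omega>. of_bool (pred (cn l) (map (rounded I \<omega>) (scope (cn l)))) - mean (cn l)) =
       (\<Sum>\<omega>\<in>\<Omega>. of_bool (pred (cn l) (map (unround l \<omega>) (scope (cn l))))) +
       (\<Sum>\<omega>\<in>\<Omega>. \<Sum>j\<in>S l. of_bool (active (cn l) j \<omega>) *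
       ((real_of_int (rounded I \<omega> j) - real_of_int (spin \<omega> j)) / 2 * real_of_int (gain (cn l) j (spin \<omega>)))) -
       8 ^ nvars I * mean (cn l)"
      by (simp add: pred_rounded_conv_unround[OF l] sum.distrib sum_subtractf card_tosses)
    also have "\<dots> = (\<Sum>j\<in>S l. \<Sum>\<omega>\<in>\<Omega>. of_bool (active (cn l) j \<omega>) *
       ((real_of_int (rounded I \<omega> j) - real_of_int (spin \<omega> j)) / 2 * real_of_int (gain (cn l) j (spin \<omega>))))"
      unfolding sum_pred_unround[OF l] by (subst sum.swap) simp
    also have "\<dots> = (\<Sum>j\<in>S l. (\<Sum>\<omega>\<in>\<Omega>. h l j \<omega>) / 2)"
    proof (intro sum.cong refl)
      fix j assume j: "j \<in> S l"
      have "(\<Sum>\<omega>\<in>\<Omega>. of_bool (active (cn l) j \<omega>) *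
         ((real_of_int (rounded I \<omega> j) - real_of_int (spin \<omega> j)) / 2 * real_of_int (gain (cn l) j (spin \<omega>)))) =
        (\<Sum>\<omega>\<in>\<Omega>. h l j \<omega> / 2 - of_bool (active (cn l) j \<omega>) * (real_of_int (spin \<omega> j) * real_of_int (gain (cn l) j (spin \<omega>))) / 2)"
        by (intro sum.cong refl) (simp add: h_def field_simps)
      also have "\<dots> = (\<Sum>\<omega>\<in>\<Omega>. h l j \<omega>) / 2"
        using sum_spin_gain[OF l j] by (simp add: sum_subtractf flip: sum_divide_distrib)
      finally show "(\<Sum>\<omega>\<in>\<Omega>. of_bool (active (cn l) j \<omega>) *
         ((real_of_int (rounded I \<omega> j) - real_of_int (spin \<omega> j)) / 2 * real_of_int (gain (cn l) j (spin \<omega>)))) =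
         (\<Sum>\<omega>\<in>\<Omega>. h l j \<omega>) / 2" .
    qed
    also have "\<dots> = (\<Sum>j<nvars I. (\<Sum>\<omega>\<in>\<Omega>. h l j \<omega>) / 2)"
    proof (rule sum.mono_neutral_left)
      show "\<forall>j\<in>{..<nvars I} - S l. (\<Sum>\<omega>\<in>\<Omega>. h l j \<omega>) / 2 = 0"
      proof
        fix j assume "j \<in> {..<nvars I} - S l"
        then have "\<not> active (cn l) j \<omega>" for \<omega> using activeD(1) by blast
        then show "(\<Sum>\<omega>\<in>\<Omega>. h l j \<omega>) / 2 = 0" by (simp add: h_def)
      qed
    qed (use scope_subset[OF l] in auto)
    finally show ?thesis by (simp add: sum_divide_distrib)
  qed
  have "(\<Sum>\<omega>\<in>\<Omega>. \<Sum>l<ncons I. of_bool (pred (cn l) (map (rounded I \<omega>) (scope (cn l)))) - mean (cn l)) =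
    (\<Sum>l<ncons I. (\<Sum>j<nvars I. \<Sum>\<omega>\<in>\<Omega>. h l j \<omega>) / 2)"
    by (subst sum.swap) (intro sum.cong refl one, simp)
  also have "\<dots> = (\<Sum>j<nvars I. \<Sum>\<omega>\<in>\<Omega>. \<Sum>l<ncons I. h l j \<omega>) / 2"
    unfolding sum_divide_distrib[symmetric]
    by (subst sum.swap, subst (2) sum.swap) simp
  also have "\<dots> = (\<Sum>j<nvars I. (\<Sum>\<omega>\<in>\<Omega>. \<bar>real_of_int (tally I j \<omega>)\<bar>) / 2) / 2"
  proof (intro arg_cong[where f = "\<lambda>s. s / 2"] sum.cong refl)
    fix j assume "j \<in> {..<nvars I}"
    then have j: "j < nvars I" by simp
    show "(\<Sum>\<omega>\<in>\<Omega>. \<Sum>l<ncons I. h l j \<omega>) = (\<Sum>\<omega>\<in>\<Omega>. \<bar>real_of_int (tally I j \<omega>)\<bar>) / 2"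
      unfolding sum_rounded_gain[OF j, symmetric] h_def sum_distrib_left
      by (intro sum.cong refl) (simp add: mult_ac)
  qed
  finally show ?thesis by (simp flip: sum_divide_distrib)
qed

end

section \<open>Moments of the tally\<close>

text \<open>Prescribing one more entry divides the count by at most 8, the number of values of an
  entry: overwriting that entry in all ways covers the larger set by 8 images of the smaller
  one.\<close>

lemma card_tosses_agree:
  assumes "finite X" "X \<subseteq> {..<n}"
  shows "8 ^ n \<le> card {\<omega> \<in> tosses n. \<forall>i\<in>X. \<omega> ! i = p i} * 8 ^ card X"
  using assms
proof (induction X)
  case empty
  then show ?case by (simp add: card_tosses)
next
  case (insert i X)
  define F where "F X = {\<omega> \<in> tosses n. \<forall>i\<in>X. \<omega> ! i = p i}" for X
  have fin: "finite (F X)" for X unfolding F_def by simp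
  have "F X \<subseteq> (\<Union>c. (\<lambda>\<omega>. list_update \<omega> i c) ` F (insert i X))"
  proof
    fix \<omega> assume \<omega>: "\<omega> \<in> F X"
    have "list_update \<omega> i (p i) \<in> F (insert i X)"
      using \<omega> insert.hyps insert.prems by (auto simp: F_def tosses_def nth_list_update)
    moreover have "\<omega> = list_update (list_update \<omega> i (p i)) i (\<omega> ! i)" by simp
    ultimately show "\<omega> \<in> (\<Union>c. (\<lambda>\<omega>. list_update \<omega> i c) ` F (insert i X))" by blast
  qed
  then have "card (F X) \<le> card (\<Union>c. (\<lambda>\<omega>. list_update \<omega> i c) ` F (insert i X))"
    by (intro card_mono) (simp_all add: fin)
  also have "\<dots> \<le> (\<Sum>c\<in>UNIV. card ((\<lambda>\<omega>. list_update \<omega> i c) ` F (insert i X)))"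
    by (rule card_UN_le) simp
  also have "\<dots> \<le> (\<Sum>c\<in>(UNIV :: (bool \<times> bool \<times> bool) set). card (F (insert i X)))"
    by (intro sum_mono card_image_le fin)
  also have "\<dots> = 8 * card (F (insert i X))" by (simp add: card_coins)
  finally have "card (F X) \<le> 8 * card (F (insert i X))" .
  then have "card (F X) * 8 ^ card X \<le> 8 * card (F (insert i X)) * 8 ^ card X" by (rule mult_right_mono) simp
  moreover have "8 ^ n \<le> card (F X) * 8 ^ card X" using insert by (simp add: F_def)
  ultimately have "8 ^ n \<le> 8 * card (F (insert i X)) * 8 ^ card X" by (rule order_trans[rotated])
  then show ?case unfolding F_def using insert.hyps by (simp add: mult_ac)
qed

lemma exists_assignment:
  assumes "distinct sc" "z \<in> cube (length sc)"
  obtains x where "map x sc = z" "\<And>i. x i \<in> {-1, 1 :: int}"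
proof
  define x where "x i = (case map_of (zip sc z) i of Some a \<Rightarrow> a | None \<Rightarrow> 1)" for i
  have len: "length z = length sc" and z: "set z \<subseteq> {-1, 1}" using assms(2) by (simp_all add: cube_def)
  have nth: "x (sc ! t) = z ! t" if "t < length sc" for t
    using map_of_zip_nth[of sc z t] len assms(1) that by (simp add: x_def)
  then show "map x sc = z" by (intro nth_equalityI) (simp_all add: len)
  show "x i \<in> {-1, 1}" for i
  proof (cases "i \<in> set sc")
    case True
    then obtain t where t: "t < length sc" "i = sc ! t" unfolding in_set_conv_nth by blast
    then have "z ! t \<in> set z" by (simp add: len)
    then show ?thesis using z nth[OF t(1)] t(2) by auto
  next
    case False
    then have "map_of (zip sc z) i = None" using len by simp
    then show ?thesis by (simp add: x_def)
  qed
qed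

text \<open>A constant gain \<open>g\<close> would be nonzero because the predicate depends on
  \<open>j\<close>. The predicate would then be a dictator, true iff variable \<open>j\<close> has
  the value \<open>g\<close>, and could not depend on a second variable, which exists by the arity
  bound.\<close>

lemma gain_nonconstant:
  assumes dep: "depends_on_all (arity c) (pred c)" and dist: "distinct (scope c)"
    and ar: "2 \<le> arity c" and j: "j \<in> set (scope c)"
  obtains x x' where "\<And>i. x i \<in> {-1, 1}" "\<And>i. x' i \<in> {-1, 1}" "gain c j x \<noteq> gain c j x'"
proof -
  obtain p where p: "p < arity c" "j = scope c ! p" using j unfolding in_set_conv_nth by blast
  define q where "q = (if p = 0 then 1 else 0 :: nat)"
  have q: "q < arity c" "q \<noteq> p" using ar by (auto simp: q_def)
  have upd: "map (x(j := a)) (scope c) = (map x (scope c))[p := a]" for x :: "nat \<Rightarrow> int" and a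
    using p dist by (intro nth_equalityI) (auto simp: nth_list_update nth_eq_iff_index_eq)
  have "\<exists>x x'. (\<forall>i. x i \<in> {-1, 1}) \<and> (\<forall>i. x' i \<in> {-1, 1}) \<and> gain c j x \<noteq> gain c j x'"
  proof (rule ccontr)
    assume no: "\<not> ?thesis"
    obtain z where z: "z \<in> cube (arity c)" "pred c (z[p := - z ! p]) \<noteq> pred c z"
      using dep p(1) unfolding depends_on_all_def by blast
    obtain x where x: "map x (scope c) = z" "\<And>i. x i \<in> {-1, 1}"
      using exists_assignment[OF dist z(1)] by blast
    have len: "length z = arity c" using z(1) by (simp add: cube_def)
    then have zp: "z ! p \<in> {-1, 1}" using z(1) p(1) nth_mem[of p z] unfolding cube_def by force
    define g where "g = gain c j x"
    have "z[p := z ! p] = z" by simp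
    with zp z(2) have "g \<noteq> 0" unfolding g_def gain_def upd x(1) by (elim insertE emptyE) auto
    have const: "gain c j x' = g" if "\<forall>i. x' i \<in> {-1, 1}" for x'
      using no x(2) that unfolding g_def by blast
    have dictator: "pred c w \<longleftrightarrow> w ! p = g" if w: "w \<in> cube (arity c)" for w
    proof -
      obtain y where y: "map y (scope c) = w" "\<And>i. y i \<in> {-1, 1}"
        using exists_assignment[OF dist w] by blast
      have "length w = arity c" using w by (simp add: cube_def)
      then have wp: "w ! p \<in> {-1, 1}" using w p(1) nth_mem[of p w] unfolding cube_def by force
      have g: "of_bool (pred c (w[p := 1])) - of_bool (pred c (w[p := -1])) = g"
        using const[of y] y(2) unfolding gain_def upd y(1) by blast
      have "pred c w \<longleftrightarrow> pred c (w[p := w ! p])" by simp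
      also have "\<dots> \<longleftrightarrow> (if w ! p = 1 then pred c (w[p := 1]) else pred c (w[p := -1]))"
        using wp by (cases "w ! p = 1") (simp_all only: insert_iff empty_iff if_True if_False simp_thms)
      finally have pw: "pred c w \<longleftrightarrow> (if w ! p = 1 then pred c (w[p := 1]) else pred c (w[p := -1]))" .
      show ?thesis
        unfolding pw using wp g \<open>g \<noteq> 0\<close>
        by (cases "pred c (w[p := 1])"; cases "pred c (w[p := -1])") auto
    qed
    obtain w where w: "w \<in> cube (arity c)" "pred c (w[q := - w ! q]) \<noteq> pred c w"
      using dep q(1) unfolding depends_on_all_def by blast
    have "w[q := - w ! q] ! p = w ! p" using q(2) by simp
    then show False using w dictator[OF w(1)] dictator[OF cube_update[OF w(1) q(1)]] by simp
  qed
  then show ?thesis using that by blast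
qed

text \<open>With \<open>t = \<alpha> * \<bar>z\<bar>\<close> the claim becomes
  \<open>0 \<le> t * (1 - t + t ^ 3 / 4)\<close>.\<close>

lemma abs_ge_quartic:
  fixes z \<alpha> :: real
  assumes "\<alpha> > 0"
  shows "\<alpha> * z\<^sup>2 - \<alpha> ^ 3 * z ^ 4 / 4 \<le> \<bar>z\<bar>"
proof -
  define t where "t = \<alpha> * \<bar>z\<bar>"
  have t: "t \<ge> 0" using assms by (simp add: t_def)
  have "0 \<le> 1 - t + t ^ 3 / 4"
  proof -
    \<comment> \<open>This is the cubic with double root \<open>s\<close> and simple root
      \<open>-2 s\<close> for \<open>s = 6 / 5\<close>, a rational point near
      \<open>2 / sqrt 3\<close>, where \<open>1 - t + t ^ 3 / 4\<close> is smallest.\<close>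
    have "0 \<le> (t - 6 / 5)\<^sup>2 * (t + 12 / 5)" using t by (intro mult_nonneg_nonneg) auto
    also have "\<dots> = t ^ 3 - 108 / 25 * t + 432 / 125"
      by (simp add: power2_eq_square power3_eq_cube field_simps)
    finally show ?thesis using t by simp
  qed
  then have "0 \<le> t * (1 - t + t ^ 3 / 4)" using t by (rule mult_nonneg_nonneg[rotated])
  then have "t\<^sup>2 - t ^ 4 / 4 \<le> t" by (simp add: power2_eq_square power3_eq_cube power4_eq_xxxx algebra_simps)
  then have "\<alpha> * (\<alpha> * z\<^sup>2 - \<alpha> ^ 3 * z ^ 4 / 4) \<le> \<alpha> * \<bar>z\<bar>"
    by (simp add: t_def power_mult_distrib algebra_simps power2_eq_square power3_eq_cube power4_eq_xxxx)
  then show ?thesis using assms by (simp add: mult_le_cancel_left_pos)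
qed

section \<open>Second and fourth moments\<close>

context triangle_free_csp
begin

definition incident :: "nat \<Rightarrow> nat set" where
  "incident j = {l. l < ncons I \<and> j \<in> S l}"

lemma finite_incident [simp]: "finite (incident j)"
  by (simp add: incident_def)

lemma deg_conv_incident: "deg I j = card (incident j)"
  by (simp add: deg_def incident_def)

text \<open>Restricting to a set of constraints allows the moments to be built up one constraint at
  a time.\<close>

definition partial_tally :: "nat \<Rightarrow> nat set \<Rightarrow> coins \<Rightarrow> real" where
  "partial_tally j A \<omega> = (\<Sum>l\<in>A. real_of_int (vote (cn l) j \<omega>))"

lemma tally_conv_partial: "real_of_int (tally I j \<omega>) = partial_tally j (incident j) \<omega>"
proof -
  have "vote (cn l) j \<omega> = 0" if "l \<notin> incident j" "l < ncons I" for l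
    using that activeD(1) vote_inactive unfolding incident_def by blast
  then show ?thesis
    unfolding tally_def partial_tally_def of_int_sum
    by (intro sum.mono_neutral_right) (auto simp: incident_def)
qed

lemma vote_abs_le: "\<bar>real_of_int (vote c j \<omega>)\<bar> \<le> 2"
proof -
  have "\<bar>vote c j \<omega>\<bar> \<le> 2"
    using gain_abs_le[of c j "spin \<omega>"] gain_abs_le[of c j "spin' \<omega>"] by (auto simp: vote_def)
  then show ?thesis by linarith
qed

text \<open>Exchanging the two signs on the other variables of constraint \<open>l\<close> negates
  its vote and keeps \<open>h\<close>, so the terms cancel.\<close>

lemma sum_vote_odd:
  assumes l: "l \<in> incident j"
    and h: "\<And>\<omega>. \<omega> \<in> \<Omega> \<Longrightarrow> h (twist (S l - {j}) {} \<omega>) = h \<omega>"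
  shows "(\<Sum>\<omega>\<in>\<Omega>. real_of_int (vote (cn l) j \<omega>) * h \<omega>) = 0" (is "sum ?f \<Omega> = 0")
proof -
  have "sum ?f \<Omega> = (\<Sum>\<omega>\<in>\<Omega>. ?f (twist (S l - {j}) {} \<omega>))"
    by (rule sum_twist[where A = "\<lambda>_. S l - {j}" and B = "{}", symmetric]) simp
  also have "\<dots> = (\<Sum>\<omega>\<in>\<Omega>. - ?f \<omega>)"
    using l h by (intro sum.cong refl) (simp add: incident_def vote_twist_neg)
  finally show ?thesis by (simp add: sum_negf)
qed

text \<open>Two distinct constraints containing \<open>j\<close> share no other variable.\<close>

lemma partial_tally_twist:
  assumes "A \<subseteq> incident j" "l \<in> incident j" "l \<notin> A" "\<omega> \<in> \<Omega>"
  shows "partial_tally j A (twist (S l - {j}) {} \<omega>) = partial_tally j A \<omega>"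
proof -
  have "vote (cn b) j (twist (S l - {j}) {} \<omega>) = vote (cn b) j \<omega>" if b: "b \<in> A" for b
  proof (rule vote_twist_id)
    have "b \<in> incident j" "b \<noteq> l" using b assms(1,3) by auto
    then show "(S b - {j}) \<inter> ((S l - {j}) \<union> {}) = {}"
      using two_common[of b l j] assms(2) unfolding incident_def by blast
  qed (use b assms in \<open>auto simp: incident_def\<close>)
  then show ?thesis by (simp add: partial_tally_def)
qed

lemma sum_square_le: "(\<Sum>\<omega>\<in>\<Omega>. (f \<omega>)\<^sup>2 * (real_of_int (vote c j \<omega>))\<^sup>2) \<le> 4 * (\<Sum>\<omega>\<in>\<Omega>. (f \<omega>)\<^sup>2)"
proof -
  have "(real_of_int (vote c j \<omega>))\<^sup>2 \<le> 4" for \<omega>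
    using power_mono[OF vote_abs_le[of c j \<omega>], of 2] by simp
  then have "(f \<omega>)\<^sup>2 * (real_of_int (vote c j \<omega>))\<^sup>2 \<le> (f \<omega>)\<^sup>2 * 4" for \<omega>
    by (rule mult_left_mono) simp
  then have "(\<Sum>\<omega>\<in>\<Omega>. (f \<omega>)\<^sup>2 * (real_of_int (vote c j \<omega>))\<^sup>2) \<le> (\<Sum>\<omega>\<in>\<Omega>. (f \<omega>)\<^sup>2 * 4)"
    by (rule sum_mono)
  then show ?thesis by (simp add: sum_distrib_left mult.commute)
qed

text \<open>When a vote \<open>v\<close> is added to a partial tally \<open>T\<close>, the terms odd
  in \<open>v\<close> vanish by \<open>sum_vote_odd\<close>; this replaces independence, as all
  votes share the greedy coin of \<open>j\<close>. The second moment is kept as an equality because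
  it is needed from below. With \<open>a = card A\<close>, the fourth moment grows on average by at
  most \<open>6 * 16 * a + 16\<close>, which fits \<open>48 * (a + 1) ^ 2\<close>.\<close>

lemma partial_tally_moments:
  assumes "finite A" "A \<subseteq> incident j"
  shows "(\<Sum>\<omega>\<in>\<Omega>. (partial_tally j A \<omega>)\<^sup>2) = (\<Sum>l\<in>A. \<Sum>\<omega>\<in>\<Omega>. (real_of_int (vote (cn l) j \<omega>))\<^sup>2)"
    and "(\<Sum>\<omega>\<in>\<Omega>. (partial_tally j A \<omega>)\<^sup>2) \<le> 4 * real (card A) * 8 ^ nvars I"
    and "(\<Sum>\<omega>\<in>\<Omega>. (partial_tally j A \<omega>) ^ 4) \<le> 48 * (real (card A))\<^sup>2 * 8 ^ nvars I"
proof -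
  have "(\<Sum>\<omega>\<in>\<Omega>. (partial_tally j A \<omega>)\<^sup>2) = (\<Sum>l\<in>A. \<Sum>\<omega>\<in>\<Omega>. (real_of_int (vote (cn l) j \<omega>))\<^sup>2) \<and>
    (\<Sum>\<omega>\<in>\<Omega>. (partial_tally j A \<omega>)\<^sup>2) \<le> 4 * real (card A) * 8 ^ nvars I \<and>
    (\<Sum>\<omega>\<in>\<Omega>. (partial_tally j A \<omega>) ^ 4) \<le> 48 * (real (card A))\<^sup>2 * 8 ^ nvars I"
    using assms
  proof (induction A)
    case empty
    show ?case by (simp add: partial_tally_def)
  next
    case (insert l A)
    define v where "v \<omega> = real_of_int (vote (cn l) j \<omega>)" for \<omega>
    define T where "T = partial_tally j A"
    define N :: real where "N = 8 ^ nvars I"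
    have l: "l \<in> incident j" "A \<subseteq> incident j" using insert.prems by auto
    have T_twist: "T (twist (S l - {j}) {} \<omega>) = T \<omega>" if "\<omega> \<in> \<Omega>" for \<omega>
      unfolding T_def using partial_tally_twist[OF l(2,1) insert.hyps(2) that] .
    have v_twist: "(v (twist (S l - {j}) {} \<omega>))\<^sup>2 = (v \<omega>)\<^sup>2" if "\<omega> \<in> \<Omega>" for \<omega>
      using l(1) that by (simp add: v_def incident_def vote_twist_neg)
    have odd: "(\<Sum>\<omega>\<in>\<Omega>. v \<omega> * h \<omega>) = 0" if "\<And>\<omega>. \<omega> \<in> \<Omega> \<Longrightarrow> h (twist (S l - {j}) {} \<omega>) = h \<omega>" for h
      using sum_vote_odd[where h = h, OF l(1) that] by (simp add: v_def)
    have pt: "partial_tally j (insert l A) \<omega> = v \<omega> + T \<omega>" for \<omega>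
      using insert.hyps by (simp add: partial_tally_def v_def T_def)
    have IH: "(\<Sum>\<omega>\<in>\<Omega>. (T \<omega>)\<^sup>2) = (\<Sum>l\<in>A. \<Sum>\<omega>\<in>\<Omega>. (real_of_int (vote (cn l) j \<omega>))\<^sup>2)"
      "(\<Sum>\<omega>\<in>\<Omega>. (T \<omega>)\<^sup>2) \<le> 4 * real (card A) * N"
      "(\<Sum>\<omega>\<in>\<Omega>. (T \<omega>) ^ 4) \<le> 48 * (real (card A))\<^sup>2 * N"
      using insert.IH[OF l(2)] by (simp_all add: T_def N_def)
    have second: "(\<Sum>\<omega>\<in>\<Omega>. (v \<omega> + T \<omega>)\<^sup>2) = (\<Sum>\<omega>\<in>\<Omega>. (v \<omega>)\<^sup>2) + (\<Sum>\<omega>\<in>\<Omega>. (T \<omega>)\<^sup>2)"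
    proof -
      have "(v \<omega> + T \<omega>)\<^sup>2 = (v \<omega>)\<^sup>2 + (T \<omega>)\<^sup>2 + v \<omega> * (2 * T \<omega>)" for \<omega>
        by (simp add: power2_sum)
      then show ?thesis using odd[of "\<lambda>\<omega>. 2 * T \<omega>"] T_twist by (simp add: sum.distrib)
    qed
    have v2: "(\<Sum>\<omega>\<in>\<Omega>. (v \<omega>)\<^sup>2) \<le> 4 * N"
      using sum_square_le[of "\<lambda>_. 1" "cn l" j] by (simp add: v_def N_def card_tosses)
    have v4: "(\<Sum>\<omega>\<in>\<Omega>. (v \<omega>) ^ 4) \<le> 16 * N"
    proof -
      have "(v \<omega>) ^ 4 = (v \<omega>)\<^sup>2 * (v \<omega>)\<^sup>2" for \<omega> by (simp flip: power_add)
      then show ?thesis using sum_square_le[of v "cn l" j] v2 by (simp flip: v_def)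
    qed
    have T2v2: "(\<Sum>\<omega>\<in>\<Omega>. (T \<omega>)\<^sup>2 * (v \<omega>)\<^sup>2) \<le> 16 * real (card A) * N"
      using sum_square_le[of T "cn l" j] IH(2) by (simp add: v_def)
    have fourth: "(\<Sum>\<omega>\<in>\<Omega>. (v \<omega> + T \<omega>) ^ 4) =
      (\<Sum>\<omega>\<in>\<Omega>. (v \<omega>) ^ 4) + 6 * (\<Sum>\<omega>\<in>\<Omega>. (T \<omega>)\<^sup>2 * (v \<omega>)\<^sup>2) + (\<Sum>\<omega>\<in>\<Omega>. (T \<omega>) ^ 4)"
    proof -
      \<comment> \<open>The terms odd in \<open>v\<close> are grouped as \<open>v\<close> times a
        factor even in \<open>v\<close>, which the exchange leaves unchanged.\<close>
      have "(v \<omega> + T \<omega>) ^ 4 = (v \<omega>) ^ 4 + 6 * ((T \<omega>)\<^sup>2 * (v \<omega>)\<^sup>2) + (T \<omega>) ^ 4 +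
          v \<omega> * (4 * T \<omega> * (v \<omega>)\<^sup>2 + 4 * (T \<omega>) ^ 3)" for \<omega>
        by (simp add: power4_eq_xxxx power3_eq_cube power2_eq_square algebra_simps)
      then show ?thesis
        using odd[of "\<lambda>\<omega>. 4 * T \<omega> * (v \<omega>)\<^sup>2 + 4 * (T \<omega>) ^ 3"] T_twist v_twist
        by (simp add: sum.distrib sum_distrib_left)
    qed
    have card: "real (card (insert l A)) = real (card A) + 1" using insert.hyps by simp
    have "0 \<le> N" by (simp add: N_def)
    then have "0 \<le> real (card A) * N" by simp
    then have "(\<Sum>\<omega>\<in>\<Omega>. (v \<omega> + T \<omega>) ^ 4) \<le> 48 * (real (card A) + 1)\<^sup>2 * N"
      using fourth v4 T2v2 IH(3) \<open>0 \<le> N\<close> by (simp add: power2_eq_square algebra_simps)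
    moreover have "(\<Sum>\<omega>\<in>\<Omega>. (v \<omega> + T \<omega>)\<^sup>2) \<le> 4 * (real (card A) + 1) * N"
      using second v2 IH(2) by (simp add: algebra_simps)
    ultimately show ?case
      unfolding pt card N_def[symmetric] using second IH(1) insert.hyps by (simp add: v_def)
  qed
  then show "(\<Sum>\<omega>\<in>\<Omega>. (partial_tally j A \<omega>)\<^sup>2) = (\<Sum>l\<in>A. \<Sum>\<omega>\<in>\<Omega>. (real_of_int (vote (cn l) j \<omega>))\<^sup>2)"
    "(\<Sum>\<omega>\<in>\<Omega>. (partial_tally j A \<omega>)\<^sup>2) \<le> 4 * real (card A) * 8 ^ nvars I"
    "(\<Sum>\<omega>\<in>\<Omega>. (partial_tally j A \<omega>) ^ 4) \<le> 48 * (real (card A))\<^sup>2 * 8 ^ nvars I" by blast+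
qed

text \<open>A single pattern of coins on the scope already makes the vote a nonzero integer, and it
  has probability at least \<open>1 / 8 ^ k\<close>.\<close>

lemma sum_vote_square_ge:
  assumes l: "l \<in> incident j" and k: "arity (cn l) \<le> k"
  shows "8 ^ nvars I / 8 ^ k \<le> (\<Sum>\<omega>\<in>\<Omega>. (real_of_int (vote (cn l) j \<omega>))\<^sup>2)"
proof -
  have lm: "l < ncons I" "j \<in> S l" using l by (simp_all add: incident_def)
  have c: "cn l \<in> set (constraints I)" using lm(1) by simp
  have "depends_on_all (arity (cn l)) (pred (cn l))" using valid c unfolding valid_csp_def by blast
  from gain_nonconstant[OF this distinct_scope[OF lm(1)] arity_ge_2[OF c] lm(2)]
  obtain x x' where x: "\<And>i. x i \<in> {-1, 1}" "\<And>i. x' i \<in> {-1, 1}"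
    "gain (cn l) j x \<noteq> gain (cn l) j x'" by blast
  \<comment> \<open>Only \<open>j\<close> is greedy, \<open>y\<close> follows \<open>x\<close> and
    \<open>y'\<close> follows \<open>x'\<close>, so the vote is the nonzero difference of the two
    gains.\<close>
  define F where "F = {\<omega> \<in> \<Omega>. \<forall>i\<in>S l. \<omega> ! i = (i = j, x i = -1, x' i = -1)}"
  have "1 \<le> (real_of_int (vote (cn l) j \<omega>))\<^sup>2" if "\<omega> \<in> F" for \<omega>
  proof -
    have \<omega>: "\<omega> ! i = (i = j, x i = -1, x' i = -1)" if "i \<in> S l" for i
      using that \<open>\<omega> \<in> F\<close> by (simp add: F_def)
    have "active (cn l) j \<omega>"
      using lm(2) \<omega> unfolding active_def greedy_def by auto
    moreover have "spin \<omega> i = x i" "spin' \<omega> i = x' i" if "i \<in> S l" for i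
      using \<omega>[OF that] x(1)[of i] x(2)[of i] by (auto simp: spin_def spin'_def)
    then have "gain (cn l) j (spin \<omega>) = gain (cn l) j x" "gain (cn l) j (spin' \<omega>) = gain (cn l) j x'"
      by (auto intro!: gain_cong)
    ultimately have "vote (cn l) j \<omega> \<noteq> 0" using x(3) by (simp add: vote_def)
    then have "1 \<le> \<bar>real_of_int (vote (cn l) j \<omega>)\<bar>" by linarith
    then show ?thesis using power_mono[of 1 "\<bar>real_of_int (vote (cn l) j \<omega>)\<bar>" 2] by simp
  qed
  then have "(\<Sum>\<omega>\<in>F. 1) \<le> (\<Sum>\<omega>\<in>F. (real_of_int (vote (cn l) j \<omega>))\<^sup>2)" by (rule sum_mono)
  also have "\<dots> \<le> (\<Sum>\<omega>\<in>\<Omega>. (real_of_int (vote (cn l) j \<omega>))\<^sup>2)"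
    by (rule sum_mono2) (auto simp: F_def)
  finally have F_le: "real (card F) \<le> (\<Sum>\<omega>\<in>\<Omega>. (real_of_int (vote (cn l) j \<omega>))\<^sup>2)" by simp
  have "8 ^ nvars I \<le> card F * 8 ^ card (S l)"
    unfolding F_def using scope_subset[OF lm(1)] by (intro card_tosses_agree) auto
  then have "real (8 ^ nvars I) \<le> real (card F * 8 ^ card (S l))" by (rule of_nat_mono)
  moreover have "real (card F * 8 ^ card (S l)) \<le> real (card F) * 8 ^ k"
  proof -
    have "card (S l) \<le> k" using k card_length[of "scope (cn l)"] by linarith
    then have "(8 :: real) ^ card (S l) \<le> 8 ^ k" by (intro power_increasing) auto
    then show ?thesis by (simp add: mult_left_mono)
  qed
  ultimately have "8 ^ nvars I \<le> real (card F) * 8 ^ k" by simp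
  then have "8 ^ nvars I / 8 ^ k \<le> real (card F)" by (simp add: divide_le_eq)
  with F_le show ?thesis by simp
qed

lemma sum_abs_tally_ge:
  assumes k: "\<And>l. l < ncons I \<Longrightarrow> arity (cn l) \<le> k"
  shows "8 ^ nvars I * sqrt (deg I j) / (10 * 64 ^ k) \<le> (\<Sum>\<omega>\<in>\<Omega>. \<bar>real_of_int (tally I j \<omega>)\<bar>)"
proof (cases "deg I j = 0")
  case True
  then show ?thesis by (simp add: sum_nonneg)
next
  case False
  define d where "d = real (deg I j)"
  have d: "d > 0" using False by (simp add: d_def)
  define q :: real where "q = 1 / 8 ^ k"
  have q: "0 < q" "q \<le> 1" by (simp_all add: q_def)
  define N :: real where "N = 8 ^ nvars I"
  \<comment> \<open>This gives \<open>\<alpha> ^ 2 * d = q ^ 2 / 25\<close>, so the fourth-moment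
    term \<open>12 * \<alpha> ^ 3 * d ^ 2\<close> is at most 12/25 of the second-moment term
    \<open>\<alpha> * d * q\<close>. At least half of the latter remains, which is
    \<open>sqrt d * q ^ 2 / 10\<close>.\<close>
  define \<alpha> where "\<alpha> = q / (5 * sqrt d)"
  have \<alpha>: "\<alpha> > 0" using d q by (simp add: \<alpha>_def)
  have N: "N > 0" by (simp add: N_def)
  define T where "T \<omega> = real_of_int (tally I j \<omega>)" for \<omega>
  have moments: "(\<Sum>l\<in>incident j. \<Sum>\<omega>\<in>\<Omega>. (real_of_int (vote (cn l) j \<omega>))\<^sup>2) = (\<Sum>\<omega>\<in>\<Omega>. (T \<omega>)\<^sup>2)"
    "(\<Sum>\<omega>\<in>\<Omega>. (T \<omega>) ^ 4) \<le> 48 * d\<^sup>2 * N"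
    using partial_tally_moments(1,3)[of "incident j" j]
    by (simp_all add: tally_conv_partial T_def d_def deg_conv_incident N_def)
  have "(\<Sum>l\<in>incident j. N * q) \<le> (\<Sum>l\<in>incident j. \<Sum>\<omega>\<in>\<Omega>. (real_of_int (vote (cn l) j \<omega>))\<^sup>2)"
    using sum_vote_square_ge[of _ j k] k by (intro sum_mono) (simp add: N_def q_def incident_def)
  then have second: "d * (N * q) \<le> (\<Sum>\<omega>\<in>\<Omega>. (T \<omega>)\<^sup>2)"
    by (simp add: moments d_def deg_conv_incident)
  have sq: "\<alpha>\<^sup>2 * d = q\<^sup>2 / 25" using d by (simp add: \<alpha>_def power_divide power_mult_distrib)
  have "N * sqrt d * q\<^sup>2 / 10 = d * N * \<alpha> * (q / 2)"
    using d by (simp add: \<alpha>_def power2_eq_square field_simps)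
  also have "\<dots> \<le> d * N * \<alpha> * (q - 12 * (\<alpha>\<^sup>2 * d))"
  proof (rule mult_left_mono)
    have "q\<^sup>2 \<le> q" using q by (simp add: power2_eq_square mult_left_le)
    then show "q / 2 \<le> q - 12 * (\<alpha>\<^sup>2 * d)" unfolding sq using q by simp
  qed (use d N \<alpha> in simp)
  also have "\<dots> = \<alpha> * (d * (N * q)) - \<alpha> ^ 3 * (48 * d\<^sup>2 * N) / 4"
    by (simp add: algebra_simps power2_eq_square power3_eq_cube)
  also have "\<dots> \<le> \<alpha> * (\<Sum>\<omega>\<in>\<Omega>. (T \<omega>)\<^sup>2) - \<alpha> ^ 3 * (\<Sum>\<omega>\<in>\<Omega>. (T \<omega>) ^ 4) / 4"
    using second moments(2) \<alpha>
    by (intro diff_mono mult_left_mono divide_right_mono) auto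
  also have "\<dots> = (\<Sum>\<omega>\<in>\<Omega>. \<alpha> * (T \<omega>)\<^sup>2 - \<alpha> ^ 3 * (T \<omega>) ^ 4 / 4)"
    by (simp add: sum_subtractf sum_distrib_left sum_divide_distrib)
  also have "\<dots> \<le> (\<Sum>\<omega>\<in>\<Omega>. \<bar>T \<omega>\<bar>)"
    by (intro sum_mono abs_ge_quartic \<alpha>)
  finally have "N * sqrt d * q\<^sup>2 / 10 \<le> (\<Sum>\<omega>\<in>\<Omega>. \<bar>T \<omega>\<bar>)" .
  moreover have "q\<^sup>2 = 1 / 64 ^ k"
    by (simp add: q_def power_divide power_mult_distrib[symmetric] flip: power_mult) (simp add: power_mult mult.commute[of k])
  ultimately show ?thesis by (simp add: N_def d_def T_def)
qed

end

section \<open>The expected value of the output\<close>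

text \<open>A coupling under which the two values always agree forces equal distributions.\<close>

lemma rel_pmf_map_eq:
  assumes "rel_pmf R p q" "\<And>x y. R x y \<Longrightarrow> f x = g y"
  shows "map_pmf f p = map_pmf g q"
proof -
  have "rel_pmf (\<lambda>x y. f x = g y) p q"
    using assms by (rule pmf.rel_mono_strong)
  then have "rel_pmf (=) (map_pmf f p) (map_pmf g q)" by (simp add: pmf.rel_map)
  then show ?thesis by (simp add: pmf.rel_eq)
qed

text \<open>The output of the machine is known to agree with \<open>rounded\<close> only on indices
  below \<open>nvars I\<close>; the cells beyond hold other data.\<close>

lemma assoc_poly_cong:
  assumes "valid_csp I" "\<And>i. i < nvars I \<Longrightarrow> x i = y i"
  shows "assoc_poly I x = assoc_poly I y"
proof -
  have "map x (scope c) = map y (scope c)" if "c \<in> set (constraints I)" for c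
    using assms that unfolding valid_csp_def by (intro map_cong refl) blast
  then have "map (\<lambda>c. of_bool (pred c (map x (scope c))) - mean c) (constraints I) =
      map (\<lambda>c. of_bool (pred c (map y (scope c))) - mean c) (constraints I)"
    by (intro map_cong refl) (simp only:)
  then show ?thesis by (simp only: assoc_poly_def)
qed

lemma assoc_poly_conv_sum:
  "assoc_poly I x = (\<Sum>l<ncons I. of_bool (pred (constraints I ! l) (map x (scope (constraints I ! l))))
     - mean (constraints I ! l)) / real (ncons I)"
  by (simp add: assoc_poly_def sum_list_sum_nth lessThan_atLeast0)

text \<open>The 40 is absorbed by \<open>16 ^ k\<close>, which is at least 256, and
  \<open>16 * 64 = 2 ^ 10 \<le> exp 10\<close>.\<close>

lemma exp_le_inverse_power:
  assumes "2 \<le> k"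
  shows "exp (- (10 * real k)) \<le> 1 / (40 * 64 ^ k)"
proof -
  have "(2 :: real) ^ 10 \<le> exp 1 ^ 10" using exp_ge_add_one_self[of 1] by (intro power_mono) auto
  then have e: "1024 \<le> exp (10 :: real)" by (simp flip: exp_of_nat_mult)
  have "(40 :: real) * 64 ^ k \<le> 16 ^ k * 64 ^ k"
    using power_increasing[OF assms, of "16 :: real"] by simp
  also have "\<dots> = 1024 ^ k" by (simp flip: power_mult_distrib)
  also have "\<dots> \<le> exp 10 ^ k" using e by (rule power_mono) simp
  also have "\<dots> = exp (10 * real k)" by (simp add: exp_of_nat_mult[symmetric] mult.commute)
  finally have "1 / exp (10 * real k) \<le> 1 / (40 * 64 ^ k)" by (intro divide_left_mono) auto
  then show ?thesis by (simp add: exp_minus inverse_eq_divide)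
qed

context triangle_free_csp
begin

lemma expectation_rounded_ge:
  assumes k: "\<And>c. c \<in> set (constraints I) \<Longrightarrow> arity c \<le> k" and "2 \<le> k"
  shows "exp (- (10 * real k)) * (\<Sum>i<nvars I. sqrt (real (deg I i)) / real (ncons I)) \<le>
    measure_pmf.expectation (replicate_pmf (nvars I) toss) (\<lambda>\<omega>. assoc_poly I (rounded I \<omega>))"
proof -
  define N :: real where "N = 8 ^ nvars I"
  have N: "N > 0" by (simp add: N_def)
  have ne: "\<Omega> \<noteq> {}" using card_tosses[of "nvars I"] by force
  have "exp (- (10 * real k)) * (\<Sum>i<nvars I. sqrt (real (deg I i)) / real (ncons I)) \<le>
      1 / (40 * 64 ^ k) * (\<Sum>i<nvars I. sqrt (real (deg I i)) / real (ncons I))"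
    by (intro mult_right_mono exp_le_inverse_power assms sum_nonneg) simp
  \<comment> \<open>\<open>40 = 10 * 4\<close>: the 10 belongs to \<open>sum_abs_tally_ge\<close>,
    the 4 to \<open>sum_excess\<close>.\<close>
  also have "\<dots> = (\<Sum>j<nvars I. N * sqrt (deg I j) / (10 * 64 ^ k)) / 4 / real (ncons I) / N"
    using N by (simp add: sum_distrib_left sum_divide_distrib field_simps)
  also have "\<dots> \<le> (\<Sum>j<nvars I. \<Sum>\<omega>\<in>\<Omega>. \<bar>real_of_int (tally I j \<omega>)\<bar>) / 4 / real (ncons I) / N"
    using N k sum_abs_tally_ge[of k] unfolding N_def
    by (intro divide_right_mono sum_mono) auto
  also have "\<dots> = (\<Sum>\<omega>\<in>\<Omega>. assoc_poly I (rounded I \<omega>)) / N"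
    unfolding sum_excess[symmetric] assoc_poly_conv_sum by (simp add: sum_divide_distrib)
  also have "\<dots> = measure_pmf.expectation (replicate_pmf (nvars I) toss) (\<lambda>\<omega>. assoc_poly I (rounded I \<omega>))"
    using ne by (simp add: replicate_pmf_conv_tosses integral_pmf_of_set card_tosses N_def)
  finally show ?thesis .
qed

text \<open>Every scope is nonempty, so the degrees sum to at least \<open>ncons I\<close>, and each
  degree is at most its square root times \<open>sqrt D\<close>. For \<open>D = 0\<close> the
  left-hand side is 0, since division by zero gives 0.\<close>

lemma sum_sqrt_deg_ge:
  assumes D: "\<And>i. i < nvars I \<Longrightarrow> deg I i \<le> D" and m: "ncons I \<ge> 1"
  shows "1 / sqrt (real D) \<le> (\<Sum>i<nvars I. sqrt (real (deg I i)) / real (ncons I))"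
proof (cases "D = 0")
  case True
  then show ?thesis by (simp add: sum_nonneg)
next
  case False
  then have sD: "sqrt (real D) > 0" by simp
  have "(\<Sum>i<nvars I. deg I i) = (\<Sum>i<nvars I. \<Sum>l<ncons I. of_bool (i \<in> S l))"
    by (simp add: deg_def Int_def sum_of_bool_eq)
  also have "\<dots> = (\<Sum>l<ncons I. \<Sum>i<nvars I. of_bool (i \<in> S l))" by (rule sum.swap)
  also have "\<dots> \<ge> (\<Sum>l<ncons I. 1)"
  proof (rule sum_mono)
    fix l assume "l \<in> {..<ncons I}"
    then have l: "l < ncons I" by simp
    then have "2 \<le> arity (cn l)" using arity_ge_2 by simp
    then have "hd (scope (cn l)) \<in> S l" by (intro hd_in_set) auto
    show "(1 :: nat) \<le> (\<Sum>i<nvars I. of_bool (i \<in> S l))"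
      using member_le_sum[of "hd (scope (cn l))" "{..<nvars I}" "\<lambda>i. of_bool (i \<in> S l) :: nat"]
        \<open>hd (scope (cn l)) \<in> S l\<close> scope_subset[OF l] by (simp del: sum_of_bool_eq)
  qed
  finally have "ncons I \<le> (\<Sum>i<nvars I. deg I i)" by simp
  then have "real (ncons I) \<le> (\<Sum>i<nvars I. real (deg I i))" by (simp flip: of_nat_sum)
  also have "\<dots> \<le> (\<Sum>i<nvars I. sqrt (real (deg I i)) * sqrt (real D))"
  proof (rule sum_mono)
    fix i assume "i \<in> {..<nvars I}"
    then have "sqrt (real (deg I i)) \<le> sqrt (real D)" using D by simp
    then have "sqrt (real (deg I i)) * sqrt (real (deg I i)) \<le> sqrt (real (deg I i)) * sqrt (real D)"
      by (rule mult_left_mono) simp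
    then show "real (deg I i) \<le> sqrt (real (deg I i)) * sqrt (real D)" by simp
  qed
  finally have "real (ncons I) \<le> (\<Sum>i<nvars I. sqrt (real (deg I i))) * sqrt (real D)"
    by (simp add: sum_distrib_right)
  moreover have "real (ncons I) > 0" using m by linarith
  ultimately show ?thesis
    using sD by (simp add: divide_simps mult.commute flip: sum_divide_distrib)
qed

end

theorem theorem5p1:
  "\<exists>(alg :: com) (a :: nat) (C1 :: real) (C2 :: real). C1 > 0 \<and> C2 > 0 \<and>
     (\<forall>(I :: csp) (k :: nat) (D :: nat).
        valid_csp I \<and> triangle_free I \<and> ncons I \<ge> 1 \<and>
        (\<forall>c\<in>set (constraints I). 2 \<le> arity c \<and> arity c \<le> k) \<and>
        (\<forall>i<nvars I. deg I i \<le> D) \<longrightarrow>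
        (\<exists>T :: nat.
           real T \<le> real a * (real (ncons I) + real (nvars I) + exp (real k)) ^ a \<and>
           halts_within alg (init_state (encode_csp I)) T \<and>
           (\<forall>x\<in>set_pmf (output_dist alg (init_state (encode_csp I)) T).
              \<forall>i<nvars I. x i \<in> {-1, 1}) \<and>
           measure_pmf.expectation (output_dist alg (init_state (encode_csp I)) T) (assoc_poly I)
             \<ge> exp (- (C1 * real k)) * (\<Sum>i<nvars I. sqrt (real (deg I i)) / real (ncons I))) \<and>
        exp (- (C1 * real k)) * (\<Sum>i<nvars I. sqrt (real (deg I i)) / real (ncons I))
          \<ge> exp (- (C2 * real k)) * (1 / sqrt (real D)))"
proof (rule exI[of _ rounding], rule exI[of _ 82], rule exI[of _ 10], rule exI[of _ 10],
    intro conjI allI impI)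
  fix I :: csp and k D :: nat
  assume asm: "valid_csp I \<and> triangle_free I \<and> ncons I \<ge> 1 \<and>
        (\<forall>c\<in>set (constraints I). 2 \<le> arity c \<and> arity c \<le> k) \<and>
        (\<forall>i<nvars I. deg I i \<le> D)"
  then interpret triangle_free_csp I by unfold_locales blast+
  have m: "1 \<le> ncons I" and k: "\<And>c. c \<in> set (constraints I) \<Longrightarrow> arity c \<le> k"
    and D: "\<And>i. i < nvars I \<Longrightarrow> deg I i \<le> D" using asm by blast+
  have "constraints I ! 0 \<in> set (constraints I)" using m by (intro nth_mem) linarith
  then have k2: "2 \<le> k" using arity_ge_2 k by (meson order_trans)
  let ?s = "init_state (encode_csp I)" and ?B = "real (ncons I) + real (nvars I) + exp (real k)"
  define T where "T = 25 * nvars I + ncons I * (15 * k + 26) + 16"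
  have yields: "yields rounding ?s T (replicate_pmf (nvars I) toss) (\<lambda>\<omega> s. \<forall>i<nvars I. snd s (int i) = rounded I \<omega> i)"
    unfolding T_def using k valid by (intro rounding_correct) auto
  show "exp (- (10 * real k)) * (\<Sum>i<nvars I. sqrt (real (deg I i)) / real (ncons I))
      \<ge> exp (- (10 * real k)) * (1 / sqrt (real D))"
    using sum_sqrt_deg_ge[OF D m] by (intro mult_left_mono) auto
  have "real T \<le> real 82 * ?B ^ 82"
  proof -
    \<comment> \<open>The exponential in the base absorbs the arity, and with it the factor
      \<open>15 * k\<close> of the running time.\<close>
    have "real k \<le> exp (real k)" using exp_ge_add_one_self[of "real k"] by linarith
    then have B: "real (ncons I) \<le> ?B" "real (nvars I) \<le> ?B" "real k \<le> ?B" "1 \<le> ?B"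
      using m by (simp_all add: add_increasing2)
    have mk: "real (ncons I) * real k \<le> ?B * ?B" using B by (intro mult_mono) auto
    have B2: "?B \<le> ?B * ?B" using mult_left_mono[OF B(4), of ?B] B(4) by simp
    have "real T = 25 * real (nvars I) + 15 * (real (ncons I) * real k) + 26 * real (ncons I) + 16"
      by (simp add: T_def algebra_simps)
    \<comment> \<open>\<open>82 = 25 + 15 + 26 + 16\<close>, where each term is bounded by the
      square of the base.\<close>
    also have "\<dots> \<le> 82 * (?B * ?B)" using B mk B2 by linarith
    \<comment> \<open>The same witness serves as factor and as exponent; as the base is at least 1,
      the square is below the power 82.\<close>
    also have "?B * ?B \<le> ?B ^ 82" using power_increasing[of 2 82 ?B] B(4) by (simp add: power2_eq_square)
    finally show ?thesis by simp
  qed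
  moreover have "halts_within rounding ?s T"
    using yields_halted[OF yields] by (simp add: halts_within_def)
  moreover have "\<forall>x\<in>set_pmf (output_dist rounding ?s T). \<forall>i<nvars I. x i \<in> {-1, 1}"
    using yields_halted[OF yields] rounded_cases by (fastforce simp: output_dist_def)
  moreover have "measure_pmf.expectation (output_dist rounding ?s T) (assoc_poly I) =
      measure_pmf.expectation (replicate_pmf (nvars I) toss) (\<lambda>\<omega>. assoc_poly I (rounded I \<omega>))"
  proof -
    \<comment> \<open>Only the distributions of the value are equated, since the outputs themselves
      may differ beyond the variables.\<close>
    have "map_pmf (\<lambda>\<omega>. assoc_poly I (rounded I \<omega>)) (replicate_pmf (nvars I) toss) =
        map_pmf (\<lambda>cfg. assoc_poly I (\<lambda>i. snd (snd cfg) (int i))) (run T (rounding, ?s))"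
      using yields unfolding yields_def
      by (rule rel_pmf_map_eq) (intro assoc_poly_cong valid, simp)
    also have "\<dots> = map_pmf (assoc_poly I) (output_dist rounding ?s T)"
      unfolding output_dist_def map_pmf_comp case_prod_beta ..
    finally have "measure_pmf.expectation (map_pmf (assoc_poly I) (output_dist rounding ?s T)) (\<lambda>y. y) =
      measure_pmf.expectation (map_pmf (\<lambda>\<omega>. assoc_poly I (rounded I \<omega>)) (replicate_pmf (nvars I) toss)) (\<lambda>y. y)"
      by (simp only:)
    then show ?thesis unfolding integral_map_pmf .
  qed
  ultimately show "\<exists>T. real T \<le> real 82 * ?B ^ 82 \<and> halts_within rounding ?s T \<and>
      (\<forall>x\<in>set_pmf (output_dist rounding ?s T). \<forall>i<nvars I. x i \<in> {-1, 1}) \<and>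
      exp (- (10 * real k)) * (\<Sum>i<nvars I. sqrt (real (deg I i)) / real (ncons I)) \<le>
      measure_pmf.expectation (output_dist rounding ?s T) (assoc_poly I)"
    using expectation_rounded_ge[OF k k2] by auto
qed simp_all

end
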